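(* (i) Any 3-connected cubic graph of path-width 3 and girth 4 can be obtained from a $K_{3,3}$ by a finite number of the construction steps $C_1$ and $C_2$. (ii) Any cubic graph of path-width 3 and girth 4 can be constructed from a $K_{3,3}$ by applying a finite number of the construction steps $C_1, C_2, C_3, C_4, C_5, C_6$. Here $C_1,\dots,C_6$ are the local replacement operations on simple cubic graphs defined in the context, and a finite number of steps may be zero.
   Context: All graphs are non-empty, finite and simple. A graph is cubic if all its vertices have degree 3. $K_{r,s}$ is the complete bipartite graph with parts of sizes $r$ and $s$. The girth is the minimum length of a cycle. A path-decomposition of a graph $G$ is a sequence $V_1,\dots,V_{n'}$ of subsets (bags) of $V(G)$ such that every vertex lies in some bag, both ends of every edge lie together in some bag, and for each vertex $v$ the set $\{i : v\in V_i\}$ is an interval of consecutive integers. Its width is $\max_i |V_i|-1$; the path-width of $G$ is the minimum width of a path-decomposition of $G$. Construction steps. Each step is applied to a simple cubic graph $G'$ containing the indicated configuration of pairwise distinct named vertices and edges as a (not necessarily induced) subgraph, and yields a new cubic graph. $C_1$: Configuration: a $K_{2,3}$ with parts $\{u,v\}$ and $\{x_1,x_2,x_3\}$. Let $s_i$ be the third neighbour of $x_i$, lying outside this $K_{2,3}$ (the $s_i$ need not be distinct). Delete the edges $x_is_i$; add new vertices $y_1,y_2,y_3,z$ and the edges $x_iy_i,\ y_iz,\ y_is_i$ for $i=1,2,3$. $C_2$: Configuration: distinct vertices $u,v,x_1,y_1,y_2,y_3$ with each of $u,v$ adjacent to each of $x_1,y_2,y_3$, and $x_1y_1$ an edge.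 Delete the edges $uy_2,uy_3,vy_2,vy_3$; add new vertices $x_2,x_3$ and the edges $ux_2,vx_2,ux_3,vx_3,x_2y_2,x_3y_3,y_2y_3$. $C_3$: Configuration: a $K_{2,3}$ with parts $\{u,v\}$ and $\{x_1,x_2,x_3\}$, with $s_i$ the third neighbour of $x_i$, lying outside this $K_{2,3}$ (the $s_i$ need not be distinct). Delete the edges $x_is_i$; add new vertices $y_1,y_2,w_1,w_2,w_3,z$ and the edges $x_1y_1,\ x_2y_2,\ x_3y_2,\ y_1w_1,\ y_1w_2,\ y_2w_3,\ zw_1,\ zw_2,\ zw_3,\ w_1s_1,\ w_2s_2,\ w_3s_3$. $C_4$: Configuration: distinct vertices $u,v,x_1,w_1,w_2,w_3$ with each of $u,v$ adjacent to each of $x_1,w_2,w_3$, and $x_1w_1$ an edge. Delete the edges $x_1w_1,uw_2,uw_3,vw_2,vw_3$; add new vertices $x_2,x_3,y_1,y_2$ and the edges $ux_2,vx_2,ux_3,vx_3,\ x_2y_2,\ x_3y_2,\ x_1y_1,\ y_1w_1,\ y_1w_2,\ y_2w_3,\ w_2w_3$. $C_5$: Configuration: distinct vertices $u,v,x_1,x_2,x_3,y,s,t$ with each of $u,v$ adjacent to each of $x_1,x_2,x_3$, and edges $x_2y,\ x_3y,\ x_1s,\ yt$. Delete the edges $x_1s$ and $yt$; add new vertices $p,q$ and the edges $x_1p,\ ps,\ yq,\ qt,\ pq$. $C_6$: Configuration: the same as for $C_5$. Delete the edges $x_1s$ and $yt$; add new vertices $p,q$ and the edges $x_1p,\ yp,\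 pq,\ qs,\ qt$.
   Formalization: Part (ii) is stated for connected cubic graphs: two disjoint copies of K_{3,3} are cubic with path-width 3 and girth 4, but cannot be constructed from one K_{3,3} because every step preserves connectedness. *)

theory Defs
  imports "HOL-Library.Extended_Nat"
begin

record 'a ugraph =
  verts :: "'a set"
  edges :: "'a set set"

definition simple_graph :: "'a ugraph \<Rightarrow> bool" where
  "simple_graph G \<longleftrightarrow>
     finite (verts G) \<and> verts G \<noteq> {} \<and> (\<forall>e\<in>edges G. e \<subseteq> verts G \<and> card e = 2)"

definition degree :: "'a ugraph \<Rightarrow> 'a \<Rightarrow> nat" where
  "degree G v = card {e \<in> edges G. v \<in> e}"

definition cubic_graph :: "'a ugraph \<Rightarrow> bool" where
  "cubic_graph G \<longleftrightarrow> simple_graph G \<and> (\<forall>v\<in>verts G. degree G v = 3)"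

definition connected_graph :: "'a ugraph \<Rightarrow> bool" where
  "connected_graph G \<longleftrightarrow>
     (\<forall>u\<in>verts G. \<forall>v\<in>verts G. (u, v) \<in> {(x, y). {x, y} \<in> edges G}\<^sup>*)"

definition delete_verts :: "'a ugraph \<Rightarrow> 'a set \<Rightarrow> 'a ugraph" where
  "delete_verts G S = \<lparr>verts = verts G - S, edges = {e \<in> edges G. e \<inter> S = {}}\<rparr>"

definition k_connected :: "nat \<Rightarrow> 'a ugraph \<Rightarrow> bool" where
  "k_connected k G \<longleftrightarrow>
     card (verts G) > k \<and>
     (\<forall>S. S \<subseteq> verts G \<and> card S < k \<longrightarrow> connected_graph (delete_verts G S))"

definition biclique :: "'a set \<Rightarrow> 'a set \<Rightarrow> 'a set set" where
  "biclique A B = {{a, b} | a b. a \<in> A \<and> b \<in> B}"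

definition complete_bipartite :: "nat \<Rightarrow> nat \<Rightarrow> 'a ugraph \<Rightarrow> bool" where
  "complete_bipartite r s G \<longleftrightarrow>
     (\<exists>A B. finite A \<and> finite B \<and> card A = r \<and> card B = s \<and> A \<inter> B = {} \<and>
            verts G = A \<union> B \<and> edges G = biclique A B)"

text \<open>A cycle is the list of its vertices in cyclic order, the first one not repeated at the end.\<close>

definition is_cycle :: "'a ugraph \<Rightarrow> 'a list \<Rightarrow> bool" where
  "is_cycle G c \<longleftrightarrow>
     length c \<ge> 3 \<and> distinct c \<and>
     (\<forall>i<length c. {c ! i, c ! (Suc i mod length c)} \<in> edges G)"

text \<open>The girth of an acyclic graph is \<open>\<infinity>\<close>.\<close>

definition girth :: "'a ugraph \<Rightarrow> enat" where
  "girth G = (INF c\<in>{c. is_cycle G c}. enat (length c))"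

definition path_decomposition :: "'a ugraph \<Rightarrow> 'a set list \<Rightarrow> bool" where
  "path_decomposition G bags \<longleftrightarrow>
     (\<forall>B\<in>set bags. B \<subseteq> verts G) \<and>
     (\<forall>v\<in>verts G. \<exists>B\<in>set bags. v \<in> B) \<and>
     (\<forall>e\<in>edges G. \<exists>B\<in>set bags. e \<subseteq> B) \<and>
     (\<forall>v\<in>verts G. \<forall>i j k. i \<le> j \<and> j \<le> k \<and> k < length bags \<and>
        v \<in> bags ! i \<and> v \<in> bags ! k \<longrightarrow> v \<in> bags ! j)"

text \<open>
  A path-decomposition of a non-empty finite graph has a non-empty bag, so neither \<open>Max\<close> of the
  empty set nor truncated subtraction interferes below.
\<close>

definition decomposition_width :: "'a set list \<Rightarrow> nat" where
  "decomposition_width bags = Max (card ` set bags) - 1"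

definition path_width :: "'a ugraph \<Rightarrow> nat" where
  "path_width G = (LEAST k. \<exists>bags. path_decomposition G bags \<and> decomposition_width bags = k)"

text \<open>
  In \<open>C\<^sub>i G H\<close> the graph \<open>H\<close> arises from \<open>G\<close> by one step; the
  vertices \<open>W\<close> added by \<open>rewire\<close> are always required to be fresh.
\<close>

definition rewire ::
    "'a ugraph \<Rightarrow> 'a set \<Rightarrow> 'a set set \<Rightarrow> 'a set set \<Rightarrow> 'a ugraph" where
  "rewire G W D A = \<lparr>verts = verts G \<union> W, edges = (edges G - D) \<union> A\<rparr>"

definition C1 :: "'a ugraph \<Rightarrow> 'a ugraph \<Rightarrow> bool" where
  "C1 G H \<longleftrightarrow> (\<exists>u v x1 x2 x3 s1 s2 s3 y1 y2 y3 z.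
     distinct [u, v, x1, x2, x3] \<and>
     biclique {u, v} {x1, x2, x3} \<subseteq> edges G \<and>
     {{x1, s1}, {x2, s2}, {x3, s3}} \<subseteq> edges G \<and>
     {s1, s2, s3} \<inter> {u, v, x1, x2, x3} = {} \<and>
     distinct [y1, y2, y3, z] \<and> {y1, y2, y3, z} \<inter> verts G = {} \<and>
     H = rewire G {y1, y2, y3, z}
           {{x1, s1}, {x2, s2}, {x3, s3}}
           {{x1, y1}, {x2, y2}, {x3, y3},
            {y1, z}, {y2, z}, {y3, z},
            {y1, s1}, {y2, s2}, {y3, s3}})"

definition C2 :: "'a ugraph \<Rightarrow> 'a ugraph \<Rightarrow> bool" where
  "C2 G H \<longleftrightarrow> (\<exists>u v x1 y1 y2 y3 x2 x3.
     distinct [u, v, x1, y1, y2, y3] \<and>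
     biclique {u, v} {x1, y2, y3} \<subseteq> edges G \<and>
     {x1, y1} \<in> edges G \<and>
     distinct [x2, x3] \<and> {x2, x3} \<inter> verts G = {} \<and>
     H = rewire G {x2, x3}
           {{u, y2}, {u, y3}, {v, y2}, {v, y3}}
           {{u, x2}, {v, x2}, {u, x3}, {v, x3},
            {x2, y2}, {x3, y3}, {y2, y3}})"

definition C3 :: "'a ugraph \<Rightarrow> 'a ugraph \<Rightarrow> bool" where
  "C3 G H \<longleftrightarrow> (\<exists>u v x1 x2 x3 s1 s2 s3 y1 y2 w1 w2 w3 z.
     distinct [u, v, x1, x2, x3] \<and>
     biclique {u, v} {x1, x2, x3} \<subseteq> edges G \<and>
     {{x1, s1}, {x2, s2}, {x3, s3}} \<subseteq> edges G \<and>
     {s1, s2, s3} \<inter> {u, v, x1, x2, x3} = {} \<and>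
     distinct [y1, y2, w1, w2, w3, z] \<and> {y1, y2, w1, w2, w3, z} \<inter> verts G = {} \<and>
     H = rewire G {y1, y2, w1, w2, w3, z}
           {{x1, s1}, {x2, s2}, {x3, s3}}
           {{x1, y1}, {x2, y2}, {x3, y2},
            {y1, w1}, {y1, w2}, {y2, w3},
            {z, w1}, {z, w2}, {z, w3},
            {w1, s1}, {w2, s2}, {w3, s3}})"

definition C4 :: "'a ugraph \<Rightarrow> 'a ugraph \<Rightarrow> bool" where
  "C4 G H \<longleftrightarrow> (\<exists>u v x1 w1 w2 w3 x2 x3 y1 y2.
     distinct [u, v, x1, w1, w2, w3] \<and>
     biclique {u, v} {x1, w2, w3} \<subseteq> edges G \<and>
     {x1, w1} \<in> edges G \<and>
     distinct [x2, x3, y1, y2] \<and> {x2, x3, y1, y2} \<inter> verts G = {} \<and>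
     H = rewire G {x2, x3, y1, y2}
           {{x1, w1}, {u, w2}, {u, w3}, {v, w2}, {v, w3}}
           {{u, x2}, {v, x2}, {u, x3}, {v, x3},
            {x2, y2}, {x3, y2}, {x1, y1},
            {y1, w1}, {y1, w2}, {y2, w3}, {w2, w3}})"

definition C5 :: "'a ugraph \<Rightarrow> 'a ugraph \<Rightarrow> bool" where
  "C5 G H \<longleftrightarrow> (\<exists>u v x1 x2 x3 y s t p q.
     distinct [u, v, x1, x2, x3, y, s, t] \<and>
     biclique {u, v} {x1, x2, x3} \<subseteq> edges G \<and>
     {{x2, y}, {x3, y}, {x1, s}, {y, t}} \<subseteq> edges G \<and>
     distinct [p, q] \<and> {p, q} \<inter> verts G = {} \<and>
     H = rewire G {p, q}
           {{x1, s}, {y, t}}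
           {{x1, p}, {p, s}, {y, q}, {q, t}, {p, q}})"

definition C6 :: "'a ugraph \<Rightarrow> 'a ugraph \<Rightarrow> bool" where
  "C6 G H \<longleftrightarrow> (\<exists>u v x1 x2 x3 y s t p q.
     distinct [u, v, x1, x2, x3, y, s, t] \<and>
     biclique {u, v} {x1, x2, x3} \<subseteq> edges G \<and>
     {{x2, y}, {x3, y}, {x1, s}, {y, t}} \<subseteq> edges G \<and>
     distinct [p, q] \<and> {p, q} \<inter> verts G = {} \<and>
     H = rewire G {p, q}
           {{x1, s}, {y, t}}
           {{x1, p}, {y, p}, {p, q}, {q, s}, {q, t}})"

text \<open>
  Both sides of a step must be simple cubic graphs. For the result this is a genuine restriction
  only on \<open>C2\<close> and \<open>C4\<close>: if the edge \<open>{y2, y3}\<close> (or \<open>{w2, w3}\<close>)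
  is already present, the step would create a double edge; here the edge sets would merge, the
  result would not be cubic, and the step is not applicable.

  No closure under isomorphism is needed: the start is any copy of \<open>K\<^sub>3\<^sub>,\<^sub>3\<close>, the fresh
  vertices are arbitrary, and every step adds vertices without removing any, so that all
  intermediate graphs can live on subsets of the vertex set of the final graph.
\<close>

inductive obtainable_from_K33 ::
    "('a ugraph \<Rightarrow> 'a ugraph \<Rightarrow> bool) set \<Rightarrow> 'a ugraph \<Rightarrow> bool"
  for steps where
  K33: "complete_bipartite 3 3 G \<Longrightarrow> obtainable_from_K33 steps G"
| step: "obtainable_from_K33 steps G \<Longrightarrow> C \<in> steps \<Longrightarrow>
    cubic_graph G \<Longrightarrow> C G H \<Longrightarrow> cubic_graph H \<Longrightarrow> obtainable_from_K33 steps H"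

end

theory Submission
  imports Defs
begin

text \<open>
  Order the vertices by the first bag of a path-decomposition of width 3. Every initial segment then
  has at most three vertices with a neighbour outside (its boundary). By triangle-freeness the first
  five vertices induce a \<open>K\<^sub>2\<^sub>,\<^sub>3\<close>, say with parts \<open>{u, v}\<close> and
  \<open>{x1, x2, x3}\<close>. If a vertex of an initial segment has exactly one outside neighbour, that
  neighbour can be moved to the front without enlarging any boundary, so after the
  \<open>K\<^sub>2\<^sub>,\<^sub>3\<close> one may place the third neighbours \<open>s1, s2, s3\<close> of the
  \<open>x1, x2, x3\<close>. If they are distinct and two of them are adjacent, \<open>C2\<close> can be
  reversed; if they are distinct and independent, all three boundary vertices have two outside
  neighbours, so the next vertex must be adjacent to all of them and \<open>C1\<close> can be reversed.
  If all three coincide, the graph is \<open>K\<^sub>3\<^sub>,\<^sub>3\<close>. If exactly two coincide, there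
  is a pair of vertices separating the graph, which contradicts 3-connectedness; without that
  assumption the same kind of argument shows that one of \<open>C3\<close> to \<open>C6\<close> can be
  reversed. The smaller graph again has such an ordering starting with a
  \<open>K\<^sub>2\<^sub>,\<^sub>3\<close>, because the replaced initial segment presents the same boundary to
  the rest of the graph.
\<close>

subsection \<open>Vertex orderings with small boundaries\<close>

definition nb :: "'a ugraph \<Rightarrow> 'a \<Rightarrow> 'a set" where
  "nb G v = {w. {v, w} \<in> edges G}"

definition triangle_free :: "'a ugraph \<Rightarrow> bool" where
  "triangle_free G \<longleftrightarrow> (\<forall>x y. y \<in> nb G x \<longrightarrow> nb G x \<inter> nb G y = {})"

lemma nb_sym: "w \<in> nb G v \<longleftrightarrow> v \<in> nb G w"
  by (simp add: nb_def insert_commute)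

lemma nb_symD: "w \<in> nb G v \<Longrightarrow> v \<in> nb G w"
  by (simp add: nb_sym)

lemma edge_iff_nb: "{v, w} \<in> edges G \<longleftrightarrow> w \<in> nb G v"
  by (simp add: nb_def)

lemma degree_eq_card_nb:
  assumes "simple_graph G"
  shows "degree G v = card (nb G v)"
proof -
  have "bij_betw (\<lambda>w. {v, w}) (nb G v) {e \<in> edges G. v \<in> e}"
  proof (rule bij_betwI')
    fix e assume "e \<in> {e \<in> edges G. v \<in> e}"
    then have e: "e \<in> edges G" "v \<in> e" by auto
    with assms have "card e = 2" by (auto simp: simple_graph_def)
    with e show "\<exists>w\<in>nb G v. e = {v, w}"
      by (auto simp: card_2_iff nb_def insert_commute)
  qed (auto simp: nb_def doubleton_eq_iff)
  then show ?thesis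
    by (simp add: degree_def bij_betw_same_card)
qed

lemma cubic_graph_iff_nb:
  "cubic_graph G \<longleftrightarrow> simple_graph G \<and> (\<forall>v\<in>verts G. card (nb G v) = 3)"
  by (auto simp: cubic_graph_def degree_eq_card_nb)

lemma nb_verts:
  assumes "simple_graph G" "w \<in> nb G v"
  shows "v \<in> verts G" "w \<in> verts G" "v \<noteq> w"
  using assms by (fastforce simp: simple_graph_def nb_def)+

lemma cubicD:
  assumes "cubic_graph G"
  shows "simple_graph G" "finite (verts G)" "v \<in> verts G \<Longrightarrow> card (nb G v) = 3"
    "finite (nb G v)" "nb G v \<subseteq> verts G" "v \<notin> nb G v"
proof -
  show s: "simple_graph G" and f: "finite (verts G)" and "v \<in> verts G \<Longrightarrow> card (nb G v) = 3"
    using assms by (auto simp: cubic_graph_iff_nb simple_graph_def)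
  show n: "nb G v \<subseteq> verts G" using s nb_verts by fast
  then show "finite (nb G v)" using f finite_subset by blast
  show "v \<notin> nb G v" using s nb_verts(3) by fast
qed

lemma nb_third:
  assumes "cubic_graph G" "{a, b} \<subseteq> nb G x" "a \<noteq> b"
  obtains c where "nb G x = {a, b, c}" "c \<noteq> a" "c \<noteq> b"
proof -
  have "x \<in> verts G" using assms nb_verts(1)[OF cubicD(1)] by fast
  then have "card (nb G x) = 3" using cubicD(3)[OF assms(1)] by blast
  then have "card (nb G x - {a, b}) = 1"
    using assms(2,3) by (simp add: card_Diff_subset)
  then obtain c where "nb G x - {a, b} = {c}" using card_1_singletonE by blast
  with assms(2) that show thesis by blast
qed

lemma nb_second_third:
  assumes "cubic_graph G" "a \<in> nb G x"
  obtains b c where "nb G x = {a, b, c}" "distinct [a, b, c]"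
proof -
  have "x \<in> verts G" using assms nb_verts(1)[OF cubicD(1)] by fast
  then have c3: "card (nb G x) = 3" using cubicD(3)[OF assms(1)] by blast
  have "\<not> nb G x \<subseteq> {a}"
    using card_mono[of "{a}" "nb G x"] c3 by auto
  then obtain b where "b \<in> nb G x" "b \<noteq> a" by auto
  with nb_third[of G a b x] assms that show thesis by (metis distinct_length_2_or_more
      distinct_singleton empty_subsetI insert_subset)
qed

definition bd :: "'a ugraph \<Rightarrow> 'a set \<Rightarrow> 'a set" where
  "bd G P = {p \<in> P. \<not> nb G p \<subseteq> P}"

text \<open>Orderings are built from the far end, so no list has to be permuted when a vertex is
  moved forward. The bound concerns the sets after \<open>P\<close>, never \<open>P\<close> itself:
  this is what allows a vertex to be dropped from a segment, or two successive vertices to be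
  exchanged, by checking a single boundary.\<close>

inductive completable :: "'a ugraph \<Rightarrow> 'a set \<Rightarrow> bool" for G where
  full: "completable G (verts G)"
| step: "w \<in> verts G - P \<Longrightarrow> card (bd G (insert w P)) \<le> 3 \<Longrightarrow>
    completable G (insert w P) \<Longrightarrow> completable G P"

lemma completable_subset: "completable G P \<Longrightarrow> P \<subseteq> verts G"
  by (induction rule: completable.induct) auto

lemma completable_next:
  assumes "completable G P" "P \<noteq> verts G"
  obtains w where "w \<in> verts G" "w \<notin> P" "card (bd G (insert w P)) \<le> 3"
    "completable G (insert w P)"
  using assms by (auto elim: completable.cases)

text \<open>Serves to release a vertex from a segment. The triple \<open>{a, b, c}\<close> may
  repeat entries, which covers smaller boundaries as well.\<close>

lemma completable_down:
  assumes "completable G (insert w P)" "w \<notin> P" "bd G (insert w P) \<subseteq> {a, b, c}"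
  shows "completable G P"
proof (rule completable.step)
  show "w \<in> verts G - P" using assms completable_subset by blast
  have "card (bd G (insert w P)) \<le> card {a, b, c}"
    using assms(3) by (intro card_mono) auto
  also have "\<dots> \<le> 3" by (simp add: card_insert_if)
  finally show "card (bd G (insert w P)) \<le> 3" .
qed (fact assms)

text \<open>As long as \<open>t\<close> is missing, \<open>x\<close> occupies a place in the
  boundary. Putting \<open>t\<close> first frees that place and takes at most one, so no later
  boundary grows; where \<open>t\<close> stood originally, both orderings have used the same
  vertices.\<close>

lemma completable_absorb:
  assumes "completable G P" "cubic_graph G" "x \<in> P" "t \<in> nb G x" "t \<notin> P" "nb G x \<subseteq> insert t P"
  shows "completable G (insert t P)"
  using assms
proof (induction rule: completable.induct)
  case full
  then show ?case using cubicD(5) by fast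
next
  case (step w P)
  show ?case
  proof (cases "w = t")
    case False
    let ?Q = "insert w P"
    have fin: "finite (bd G ?Q)"
      using completable_subset[OF step.hyps(3)] cubicD(2)[OF step.prems(1)]
      by (auto intro: finite_subset simp: bd_def)
    have x: "x \<in> bd G ?Q" using step.prems False by (auto simp: bd_def)
    have "bd G (insert t ?Q) \<subseteq> insert t (bd G ?Q - {x})"
      using step.prems by (auto simp: bd_def)
    then have "card (bd G (insert t ?Q)) \<le> card (insert t (bd G ?Q - {x}))"
      using fin by (intro card_mono) auto
    also have "\<dots> \<le> Suc (card (bd G ?Q - {x}))" by (simp add: card_insert_le_m1 card_insert_if fin)
    also have "\<dots> = card (bd G ?Q)" using x fin by (metis card_Suc_Diff1)
    finally have "card (bd G (insert w (insert t P))) \<le> 3"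
      using step.hyps by (simp add: insert_commute)
    moreover have "completable G (insert w (insert t P))"
      using step.IH step.prems False by (auto simp: insert_commute)
    moreover have "w \<in> verts G - insert t P" using step.hyps False by auto
    ultimately show ?thesis by (rule completable.step[rotated])
  qed (use step in simp)
qed

text \<open>The next vertex \<open>z\<close> closes none of the \<open>fi\<close>, so these fill all
  three places in the boundary and \<open>z\<close> must be closed at once. Its neighbours then lie
  in \<open>P\<close>, where only the \<open>fi\<close> have outside edges; by cubicity
  \<open>z\<close> is adjacent to all three.\<close>

lemma completable_cap:
  assumes "completable G P" "cubic_graph G" "distinct [f1, f2, f3]" "{f1, f2, f3} \<subseteq> P"
    and open_f: "\<And>f w. f \<in> {f1, f2, f3} \<Longrightarrow> \<not> nb G f \<subseteq> insert w P"
    and closed: "\<And>p. p \<in> P \<Longrightarrow> p \<notin> {f1, f2, f3} \<Longrightarrow> nb G p \<subseteq> P"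
  obtains z where "z \<notin> P" "nb G z = {f1, f2, f3}" "completable G (insert z P)"
proof -
  have "P \<noteq> verts G" using open_f cubicD(5)[OF assms(2)] by blast
  then obtain z where z: "z \<in> verts G" "z \<notin> P" "card (bd G (insert z P)) \<le> 3"
    "completable G (insert z P)"
    using assms(1) completable_next by metis
  have F: "{f1, f2, f3} \<subseteq> bd G (insert z P)"
    using assms(4) open_f unfolding bd_def by blast
  have "finite (bd G (insert z P))"
    using completable_subset[OF z(4)] cubicD(2)[OF assms(2)]
    by (auto intro: finite_subset simp: bd_def)
  moreover have "card {f1, f2, f3} = 3" using assms(3) by simp
  ultimately have "bd G (insert z P) = {f1, f2, f3}"
    using F z(3) card_seteq by metis
  then have "z \<notin> bd G (insert z P)" using z(2) assms(4) by blast
  then have "nb G z \<subseteq> insert z P" by (simp add: bd_def)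
  then have "nb G z \<subseteq> P" using cubicD(6)[OF assms(2)] by blast
  then have "nb G z \<subseteq> {f1, f2, f3}" using closed z(2) nb_sym by fast
  then have "nb G z = {f1, f2, f3}"
    using card_subset_eq[of "{f1, f2, f3}" "nb G z"] assms(3) cubicD(3)[OF assms(2) z(1)] by simp
  with z that show thesis by blast
qed

text \<open>Supplies the premise \<open>open_f\<close> of \<open>completable_cap\<close>: two of the
  three neighbours lie outside \<open>P\<close>, and a single further vertex cannot be both.\<close>

lemma two_outside:
  assumes "cubic_graph G" "x \<in> nb G f" "\<And>c. c \<in> nb G f \<Longrightarrow> c \<noteq> x \<Longrightarrow> c \<notin> P"
  shows "\<not> nb G f \<subseteq> insert w P"
proof -
  obtain a b where ab: "nb G f = {x, a, b}" "distinct [x, a, b]"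
    using nb_second_third[OF assms(1,2)] .
  then have "a \<notin> P" "b \<notin> P" using assms(3)[of a] assms(3)[of b] by auto
  then show ?thesis using ab by auto
qed

text \<open>With \<open>k = 1\<close> this carries the connectedness and with \<open>k = 3\<close> the 3-connectedness
  of \<open>G\<close> through the induction; unlike these, it refers only to cuts that do not split \<open>P\<close>.\<close>

definition attached :: "nat \<Rightarrow> 'a ugraph \<Rightarrow> 'a set \<Rightarrow> bool" where
  "attached k G P \<longleftrightarrow>
     (\<forall>Y. Y \<noteq> {} \<and> Y \<subseteq> verts G - P \<longrightarrow> k \<le> card (\<Union>(nb G ` Y) - Y))"

lemma attached_le: "attached k G P \<Longrightarrow> j \<le> k \<Longrightarrow> attached j G P"
  unfolding attached_def by (meson le_trans)

lemma attached_mono: "attached k G P \<Longrightarrow> P \<subseteq> Q \<Longrightarrow> attached k G Q"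
  unfolding attached_def by blast

text \<open>Needed where a reverse step leaves a segment larger than a
  \<open>K\<^sub>2\<^sub>,\<^sub>3\<close>. The bound 1 survives the release of \<open>w\<close>
  because a set \<open>Y\<close> containing \<open>w\<close> still has the outer neighbour
  \<open>p\<close>.\<close>

lemma attached_down:
  assumes "attached 1 G (insert w P)" "cubic_graph G" "w \<in> nb G p" "p \<in> P"
  shows "attached 1 G P"
  unfolding attached_def
proof (intro allI impI)
  fix Y assume Y: "Y \<noteq> {} \<and> Y \<subseteq> verts G - P"
  show "1 \<le> card (\<Union>(nb G ` Y) - Y)"
  proof (cases "w \<in> Y")
    case True
    then have "p \<in> \<Union>(nb G ` Y) - Y" using assms Y nb_sym by fast
    moreover have "finite (\<Union>(nb G ` Y) - Y)"
      using cubicD[OF assms(2)] Y by (meson finite_Diff UN_least finite_subset)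
    ultimately show ?thesis by (metis One_nat_def Suc_leI card_gt_0_iff empty_iff)
  next
    case False
    then show ?thesis using assms(1) Y unfolding attached_def by blast
  qed
qed

section \<open>Replacing an initial segment while preserving its interface\<close>

text \<open>A triple \<open>(f, f', r)\<close> of \<open>K\<close> stands for the edge from \<open>P\<close> to
  \<open>r \<in> R\<close> that leaves \<open>f\<close> in \<open>G\<close> and \<open>f'\<close> in \<open>G'\<close>.\<close>

locale surgery =
  fixes G G' :: "'a ugraph" and P P' R :: "'a set" and K :: "('a \<times> 'a \<times> 'a) set"
  assumes cubic: "cubic_graph G" and tri: "triangle_free G"
    and verts: "verts G = P \<union> R" "verts G' = P' \<union> R" "P \<inter> R = {}" "P' \<inter> R = {}"
    and fin: "finite P'" "P' \<noteq> {}"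
    and edges': "\<And>e. e \<in> edges G' \<Longrightarrow> e \<subseteq> verts G' \<and> card e = 2"
    and card': "\<And>p. p \<in> P' \<Longrightarrow> card (nb G' p) = 3"
    and tri': "\<And>p q. p \<in> P' \<Longrightarrow> q \<in> P' \<Longrightarrow> q \<in> nb G' p \<Longrightarrow> nb G' p \<inter> nb G' q = {}"
    and RR: "\<And>r r'. r \<in> R \<Longrightarrow> r' \<in> R \<Longrightarrow> r' \<in> nb G' r \<longleftrightarrow> r' \<in> nb G r"
    and K: "\<And>f f' r. (f, f', r) \<in> K \<Longrightarrow> f \<in> P \<and> f' \<in> P'"
    and PR: "\<And>p r. p \<in> P \<Longrightarrow> r \<in> R \<Longrightarrow> r \<in> nb G p \<longleftrightarrow> (\<exists>p'. (p, p', r) \<in> K)"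
    and PR': "\<And>p r. p \<in> P' \<Longrightarrow> r \<in> R \<Longrightarrow> r \<in> nb G' p \<longleftrightarrow> (\<exists>p0. (p0, p, r) \<in> K)"
    and K_inj: "\<And>f f' r g g' s. (f, f', r) \<in> K \<Longrightarrow> (g, g', s) \<in> K \<Longrightarrow> f = g \<longleftrightarrow> f' = g'"
begin

text \<open>The identity on \<open>R\<close>, and on the ends in \<open>P'\<close> of outside edges
  the matching induced by \<open>K\<close>, where \<open>K_inj\<close> makes the choice unique.
  Elsewhere in \<open>P'\<close> the value is arbitrary and never inspected.\<close>

definition \<psi> where "\<psi> x = (if x \<in> R then x else SOME f. \<exists>r. (f, x, r) \<in> K)"

lemma psi_R: "r \<in> R \<Longrightarrow> \<psi> r = r"
  by (simp add: \<psi>_def)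

lemma psi_K: "(f, f', r) \<in> K \<Longrightarrow> \<psi> f' = f"
proof -
  assume a: "(f, f', r) \<in> K"
  then have "f' \<notin> R" using K verts by blast
  moreover have "(SOME g. \<exists>r. (g, f', r) \<in> K) = f"
    using a K_inj by (intro some_equality) blast+
  ultimately show ?thesis by (simp add: \<psi>_def)
qed

lemma simple': "simple_graph G'"
  using cubicD(2)[OF cubic] fin verts edges' by (auto simp: simple_graph_def)

text \<open>A vertex of \<open>R\<close> keeps its edges into \<open>R\<close>, and \<open>K\<close>
  carries its remaining edges over from \<open>P\<close> to \<open>P'\<close>. Since
  \<open>K_inj\<close> works in both directions, no two edges at \<open>r\<close> merge.\<close>

lemma nb_R:
  assumes r: "r \<in> R"
  shows "bij_betw \<psi> (nb G' r) (nb G r)"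
proof -
  have K2: "(\<psi> x, x, r) \<in> K" if "x \<in> nb G' r" "x \<notin> R" for x
  proof -
    have "x \<in> P'" using that nb_verts(2)[OF simple'] verts by fast
    then have "\<exists>p0. (p0, x, r) \<in> K" using PR'[of x r] that r nb_sym by metis
    then show ?thesis using psi_K by blast
  qed
  have "inj_on \<psi> (nb G' r)"
  proof (rule inj_onI)
    fix x y assume xy: "x \<in> nb G' r" "y \<in> nb G' r" "\<psi> x = \<psi> y"
    show "x = y"
    proof (cases "x \<in> R"; cases "y \<in> R")
      assume "x \<in> R" "y \<in> R" then show ?thesis using xy psi_R by simp
    next
      assume "x \<in> R" "y \<notin> R" then show ?thesis using xy psi_R K2 K verts by (metis disjoint_iff)
    next
      assume "x \<notin> R" "y \<in> R" then show ?thesis using xy psi_R K2 K verts by (metis disjoint_iff)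
    next
      assume "x \<notin> R" "y \<notin> R" then show ?thesis using xy K2 K_inj by metis
    qed
  qed
  moreover have "\<psi> ` nb G' r = nb G r"
  proof
    show "\<psi> ` nb G' r \<subseteq> nb G r"
    proof
      fix w assume "w \<in> \<psi> ` nb G' r"
      then obtain x where x: "x \<in> nb G' r" "w = \<psi> x" by auto
      show "w \<in> nb G r"
      proof (cases "x \<in> R")
        case True then show ?thesis using x psi_R RR r by simp
      next
        case False
        then have "(w, x, r) \<in> K" using x K2 by simp
        then show ?thesis using PR K r nb_sym by metis
      qed
    qed
    show "nb G r \<subseteq> \<psi> ` nb G' r"
    proof
      fix w assume w: "w \<in> nb G r"
      show "w \<in> \<psi> ` nb G' r"
      proof (cases "w \<in> R")
        case True then show ?thesis using w psi_R RR r by force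
      next
        case False
        then have "w \<in> P" using w cubicD(5)[OF cubic] verts by fast
        then obtain p' where p': "(w, p', r) \<in> K" using PR r w nb_sym by metis
        then have "p' \<in> nb G' r" using PR' K r nb_sym by metis
        then show ?thesis using psi_K[OF p'] by force
      qed
    qed
  qed
  ultimately show ?thesis by (simp add: bij_betw_def)
qed

lemma cubic': "cubic_graph G'"
  unfolding cubic_graph_iff_nb
proof (intro conjI ballI simple')
  fix v assume "v \<in> verts G'"
  then show "card (nb G' v) = 3"
    using card' bij_betw_same_card[OF nb_R] cubicD(3)[OF cubic] verts by auto
qed

lemma psi_nb:
  assumes "r \<in> R" "x \<in> nb G' r"
  shows "\<psi> x \<in> nb G r"
  using nb_R[OF assms(1)] assms(2) by (auto simp: bij_betw_def)

lemma no_R_triangle: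
  assumes "r \<in> R" "r' \<in> R" "r' \<in> nb G' r" "z \<in> nb G' r" "z \<in> nb G' r'"
  shows False
proof -
  have "\<psi> z \<in> nb G r" "\<psi> z \<in> nb G r'" "r' \<in> nb G r" using psi_nb assms RR by auto
  then show False using tri unfolding triangle_free_def by blast
qed

text \<open>A triangle of \<open>G'\<close> has two vertices in \<open>P'\<close>, which
  \<open>tri'\<close> forbids, or two in \<open>R\<close>; in the latter case \<open>\<psi>\<close>
  sends the third vertex to a common neighbour in \<open>G\<close>.\<close>

lemma triangle_free': "triangle_free G'"
  unfolding triangle_free_def
proof (intro allI impI, rule ccontr)
  fix x y assume xy: "y \<in> nb G' x" "nb G' x \<inter> nb G' y \<noteq> {}"
  then obtain z where z: "z \<in> nb G' x" "z \<in> nb G' y" by auto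
  have V: "x \<in> P' \<union> R" "y \<in> P' \<union> R" "z \<in> P' \<union> R"
    using xy z nb_verts[OF simple'] verts by metis+
  have s: "x \<in> nb G' y" "x \<in> nb G' z" "y \<in> nb G' z" using xy z nb_sym by metis+
  show False
    using V tri'[of x y] tri'[of x z] tri'[of y z] no_R_triangle[of x y z]
      no_R_triangle[of x z y] no_R_triangle[of y z x] xy z s by blast
qed

text \<open>\<open>\<psi>\<close> injects the boundary in \<open>G'\<close> into the one in
  \<open>G\<close>: a boundary vertex in \<open>P'\<close> has an edge to \<open>R - Y\<close>, and
  \<open>K\<close> assigns the same outer end to a vertex of \<open>P\<close>.\<close>

lemma bd_card_le:
  assumes "Y \<subseteq> R"
  shows "card (bd G' (P' \<union> Y)) \<le> card (bd G (P \<union> Y))"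
proof (rule card_inj_on_le)
  have K2: "\<exists>r. r \<in> R - Y \<and> (\<psi> x, x, r) \<in> K" if "x \<in> bd G' (P' \<union> Y)" "x \<notin> R" for x
  proof -
    have "x \<in> P'" using that assms by (auto simp: bd_def)
    from that obtain r where r: "r \<in> nb G' x" "r \<notin> P' \<union> Y" by (auto simp: bd_def)
    then have "r \<in> R" using nb_verts(2)[OF simple'] verts by fast
    with r \<open>x \<in> P'\<close> obtain p0 where "(p0, x, r) \<in> K" using PR' by metis
    then show ?thesis using psi_K r \<open>r \<in> R\<close> by blast
  qed
  show "inj_on \<psi> (bd G' (P' \<union> Y))"
  proof (rule inj_onI)
    fix x y assume xy: "x \<in> bd G' (P' \<union> Y)" "y \<in> bd G' (P' \<union> Y)" "\<psi> x = \<psi> y"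
    show "x = y"
    proof (cases "x \<in> R"; cases "y \<in> R")
      assume "x \<in> R" "y \<in> R" then show ?thesis using xy psi_R by simp
    next
      assume "x \<in> R" "y \<notin> R" then show ?thesis using xy psi_R K2 K verts by (metis disjoint_iff)
    next
      assume "x \<notin> R" "y \<in> R" then show ?thesis using xy psi_R K2 K verts by (metis disjoint_iff)
    next
      assume "x \<notin> R" "y \<notin> R" then show ?thesis using xy K2 K_inj by metis
    qed
  qed
  show "\<psi> ` bd G' (P' \<union> Y) \<subseteq> bd G (P \<union> Y)"
  proof
    fix w assume "w \<in> \<psi> ` bd G' (P' \<union> Y)"
    then obtain x where x: "x \<in> bd G' (P' \<union> Y)" "w = \<psi> x" by auto
    show "w \<in> bd G (P \<union> Y)"
    proof (cases "x \<in> R")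
      case True
      then have "x \<in> Y" using x verts by (auto simp: bd_def)
      from x obtain r where r: "r \<in> nb G' x" "r \<notin> P' \<union> Y" by (auto simp: bd_def)
      then have "r \<in> R" using nb_verts(2)[OF simple'] verts by fast
      then have "r \<in> nb G x" using r RR True by simp
      then show ?thesis using r \<open>r \<in> R\<close> \<open>x \<in> Y\<close> verts psi_R[OF True] x(2) by (auto simp: bd_def)
    next
      case False
      then obtain r where "r \<in> R - Y" "(w, x, r) \<in> K" using x K2 by auto
      moreover then have "w \<in> P" "r \<in> nb G w" using PR K by blast+
      ultimately show ?thesis using verts by (auto simp: bd_def)
    qed
  qed
  show "finite (bd G (P \<union> Y))"
    using cubicD(2)[OF cubic] verts assms by (auto simp: bd_def intro: finite_subset)
qed

text \<open>The vertices of \<open>R\<close> are added in the same order as in \<open>G\<close>. The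
  induction runs over the later sets \<open>Q\<close> of that ordering, whose counterpart in
  \<open>G'\<close> has \<open>P\<close> replaced by \<open>P'\<close>.\<close>

lemma completable':
  assumes "completable G P"
  shows "completable G' P'"
proof -
  have "completable G' (P' \<union> (Q - P))" if "completable G Q" "P \<subseteq> Q" for Q
    using that
  proof (induction rule: completable.induct)
    case full
    have "P' \<union> (verts G - P) = verts G'" using verts by auto
    then show ?case using completable.full by metis
  next
    case (step w Q)
    have Q: "insert w Q \<subseteq> P \<union> R" using completable_subset[OF step.hyps(3)] verts by simp
    then have w: "w \<in> R" using step by auto
    have e: "P' \<union> (insert w Q - P) = insert w (P' \<union> (Q - P))" using w verts by auto
    have "card (bd G' (P' \<union> (insert w Q - P))) \<le> card (bd G (P \<union> (insert w Q - P)))"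
      using Q by (intro bd_card_le) auto
    also have "P \<union> (insert w Q - P) = insert w Q" using step.prems by auto
    finally have "card (bd G' (insert w (P' \<union> (Q - P)))) \<le> 3" using step.hyps e by simp
    moreover have "completable G' (insert w (P' \<union> (Q - P)))" using step e by auto
    moreover have "w \<in> verts G' - (P' \<union> (Q - P))" using w verts step.hyps by auto
    ultimately show ?case by (rule completable.step[rotated])
  qed
  from this[OF assms] show ?thesis by simp
qed

text \<open>\<open>\<psi>\<close> fixes \<open>Y\<close>, and the images of the outer neighbours of
  \<open>Y\<close> in \<open>G'\<close> cover those in \<open>G\<close>; hence there are at least as
  many in \<open>G'\<close>.\<close>

lemma attached':
  assumes "attached k G P"
  shows "attached k G' P'"
  unfolding attached_def
proof (intro allI impI)
  fix Y assume Y: "Y \<noteq> {} \<and> Y \<subseteq> verts G' - P'"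
  then have YR: "Y \<subseteq> R" using verts by auto
  then have "Y \<noteq> {} \<and> Y \<subseteq> verts G - P" using Y verts by auto
  then have "k \<le> card (\<Union>(nb G ` Y) - Y)"
    using assms by (simp add: attached_def)
  also have "\<dots> \<le> card (\<psi> ` (\<Union>(nb G' ` Y) - Y))"
  proof (rule card_mono)
    have "finite Y" using YR verts cubicD(2)[OF cubic] by (metis finite_Un finite_subset)
    then show "finite (\<psi> ` (\<Union>(nb G' ` Y) - Y))" using cubicD(4)[OF cubic'] by blast
    show "\<Union>(nb G ` Y) - Y \<subseteq> \<psi> ` (\<Union>(nb G' ` Y) - Y)"
    proof
      fix w assume "w \<in> \<Union>(nb G ` Y) - Y"
      then obtain r where r: "r \<in> Y" "w \<in> nb G r" "w \<notin> Y" by auto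
      then obtain x where x: "x \<in> nb G' r" "w = \<psi> x"
        using nb_R[of r] YR by (auto simp: bij_betw_def)
      have "x \<notin> Y" using x r YR psi_R by auto
      then show "w \<in> \<psi> ` (\<Union>(nb G' ` Y) - Y)" using x r by blast
    qed
  qed
  also have "\<dots> \<le> card (\<Union>(nb G' ` Y) - Y)"
  proof (rule card_image_le)
    have "finite Y" using YR verts cubicD(2)[OF cubic] by (metis finite_Un finite_subset)
    then show "finite (\<Union>(nb G' ` Y) - Y)" using cubicD(4)[OF cubic'] by blast
  qed
  finally show "k \<le> card (\<Union>(nb G' ` Y) - Y)" .
qed

end

subsection \<open>Reversing the construction steps\<close>

text \<open>The argument order is that of \<open>rewire\<close>: \<open>W\<close> and
  \<open>A\<close> are what the construction step has added, \<open>D\<close> is what it has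
  deleted.\<close>

definition undo :: "'a ugraph \<Rightarrow> 'a set \<Rightarrow> 'a set set \<Rightarrow> 'a set set \<Rightarrow> 'a ugraph" where
  "undo G W D A = \<lparr>verts = verts G - W, edges = (edges G - A) \<union> D\<rparr>"

lemma nb_undo:
  "nb (undo G W D A) x = {w. w \<in> nb G x \<and> {x, w} \<notin> A \<or> {x, w} \<in> D}"
  by (auto simp: nb_def undo_def)

lemma verts_undo [simp]: "verts (undo G W D A) = verts G - W"
  by (simp add: undo_def)

text \<open>The forward step deletes all of \<open>D\<close>, so an edge of \<open>G\<close> lying
  in \<open>D\<close> could be lost on the way back; hence the disjointness premise.\<close>

lemma rewire_undo:
  assumes "W \<subseteq> verts G" "A \<subseteq> edges G" "D \<inter> edges G = {}"
  shows "G = rewire (undo G W D A) W D A"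
proof -
  have "verts G - W \<union> W = verts G" "edges G - A \<union> D - D \<union> A = edges G"
    using assms by blast+
  then show ?thesis by (simp add: rewire_def undo_def)
qed

lemma undo_edges:
  assumes "simple_graph G" "\<And>w x. w \<in> W \<Longrightarrow> x \<in> nb G w \<Longrightarrow> {w, x} \<in> A"
    "\<And>e. e \<in> D \<Longrightarrow> e \<subseteq> verts G - W \<and> card e = 2" "e \<in> edges (undo G W D A)"
  shows "e \<subseteq> verts (undo G W D A) \<and> card e = 2"
proof (cases "e \<in> D")
  case False
  then have e: "e \<in> edges G" "e \<notin> A" using assms(4) by (auto simp: undo_def)
  then have e2: "e \<subseteq> verts G" "card e = 2" using assms(1) by (auto simp: simple_graph_def)
  have "w \<notin> e" if "w \<in> W" for w
  proof
    assume "w \<in> e"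
    with e2 obtain x where "e = {w, x}" by (auto simp: card_2_iff)
    with assms(2)[OF that] e show False by (auto simp: edge_iff_nb)
  qed
  with e2 show ?thesis by auto
qed (use assms in auto)

text \<open>The invariant of the induction. Path-width, girth and connectedness are replaced by an
  ordering that starts with a \<open>K\<^sub>2\<^sub>,\<^sub>3\<close>, by triangle-freeness and by
  \<open>attached\<close>, all of which can be carried through the reverse steps.\<close>

definition K23_start :: "nat \<Rightarrow> 'a ugraph \<Rightarrow> bool" where
  "K23_start k G \<longleftrightarrow> cubic_graph G \<and> triangle_free G \<and>
     (\<exists>u v. u \<in> verts G \<and> u \<noteq> v \<and> nb G u = nb G v \<and>
        completable G ({u, v} \<union> nb G u) \<and> attached k G ({u, v} \<union> nb G u))"

definition reducible :: "nat \<Rightarrow> ('a ugraph \<Rightarrow> 'a ugraph \<Rightarrow> bool) \<Rightarrow> 'a ugraph \<Rightarrow> bool" where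
  "reducible k C G \<longleftrightarrow> (\<exists>G'. C G' G \<and> K23_start k G' \<and> card (verts G') < card (verts G))"

lemma undo_card:
  assumes "finite (verts G)" "W \<subseteq> verts G" "W \<noteq> {}"
  shows "card (verts (undo G W D A)) < card (verts G)"
  using assms by (intro psubset_card_mono) auto

text \<open>Turns a reverse step into finite checks on neighbourhoods: \<open>P\<close> is an
  initial segment, \<open>W\<close> the vertices to be removed, and \<open>verts G - P\<close> plays
  the part of \<open>R\<close>. Every edge of \<open>A\<close> and \<open>D\<close> meets
  \<open>P\<close>, so nothing changes among the remaining vertices.\<close>

lemma undo_surgery:
  fixes G :: "'a ugraph" and W P :: "'a set" and D A :: "'a set set" and K :: "('a \<times> 'a \<times> 'a) set"
  assumes G': "G' = undo G W D A"
    and G: "cubic_graph G" "triangle_free G"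
    and W: "W \<subseteq> P" "W \<noteq> {}" "P - W \<noteq> {}"
    and c: "completable G P"
    and A: "A \<subseteq> edges G" "\<forall>w\<in>W. \<forall>x\<in>nb G w. {w, x} \<in> A" "\<forall>e\<in>A. e \<inter> P \<noteq> {}"
    and D: "D \<inter> edges G = {}" "\<forall>e\<in>D. e \<subseteq> verts G - W \<and> card e = 2" "\<forall>e\<in>D. e \<inter> P \<noteq> {}"
    and card': "\<forall>p\<in>P - W. card (nb G' p) = 3"
    and tri': "\<forall>p\<in>P - W. \<forall>q\<in>nb G' p. q \<in> P - W \<longrightarrow> nb G' p \<inter> nb G' q = {}"
    and KP: "\<forall>(f, f', r) \<in> K. f \<in> P \<and> f' \<in> P - W \<and> r \<notin> P \<and> r \<in> nb G f \<and> r \<in> nb G' f'"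
    and PR: "\<forall>p\<in>P. \<forall>r\<in>nb G p. r \<in> P \<or> (\<exists>p'. (p, p', r) \<in> K)"
    and PR': "\<forall>p\<in>P - W. \<forall>r\<in>nb G' p. r \<in> P \<or> (\<exists>p0. (p0, p, r) \<in> K)"
    and K_inj: "\<forall>(f, f', r) \<in> K. \<forall>(g, g', s) \<in> K. f = g \<longleftrightarrow> f' = g'"
  shows "G = rewire G' W D A" "verts G' = verts G - W" "cubic_graph G'" "triangle_free G'"
    "completable G' (P - W)" "attached k G P \<Longrightarrow> attached k G' (P - W)"
    "card (verts G') < card (verts G)"
proof -
  have P: "P \<subseteq> verts G" using completable_subset[OF c] .
  have fin: "finite (verts G)" using cubicD(2)[OF G(1)] .
  show "G = rewire G' W D A"
    unfolding G' using W P A D by (intro rewire_undo) auto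
  show "verts G' = verts G - W" by (simp add: G')
  show "card (verts G') < card (verts G)"
    unfolding G' using W P fin by (intro undo_card) auto
  have e': "e \<subseteq> verts G' \<and> card e = 2" if "e \<in> edges G'" for e
    using undo_edges[OF cubicD(1)[OF G(1)], of W A D e] A(2) D(2) that unfolding G' by blast
  have RR: "r' \<in> nb G' r \<longleftrightarrow> r' \<in> nb G r" if "r \<in> verts G - P" "r' \<in> verts G - P" for r r'
  proof -
    have "{r, r'} \<inter> P = {}" using that by blast
    then have "{r, r'} \<notin> A" "{r, r'} \<notin> D" using A(3) D(3) by blast+
    then show ?thesis by (simp add: G' nb_undo)
  qed
  interpret surgery G G' P "P - W" "verts G - P" K
  proof
    show "verts G = P \<union> (verts G - P)" using P by blast
    show "verts G' = P - W \<union> (verts G - P)" using P W by (auto simp: G')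
    show "finite (P - W)" using P fin finite_subset by blast
  next
    fix e assume "e \<in> edges G'" then show "e \<subseteq> verts G' \<and> card e = 2" by (rule e')
  next
    fix r r' assume "r \<in> verts G - P" "r' \<in> verts G - P"
    then show "r' \<in> nb G' r \<longleftrightarrow> r' \<in> nb G r" by (rule RR)
  next
    fix p r assume "p \<in> P" "r \<in> verts G - P"
    then show "r \<in> nb G p \<longleftrightarrow> (\<exists>p'. (p, p', r) \<in> K)" using PR KP by fast
  next
    fix p r assume "p \<in> P - W" "r \<in> verts G - P"
    then show "r \<in> nb G' p \<longleftrightarrow> (\<exists>p0. (p0, p, r) \<in> K)" using PR' KP by fast
  next
    fix p q assume "p \<in> P - W" "q \<in> P - W" "q \<in> nb G' p"
    then show "nb G' p \<inter> nb G' q = {}" using tri' by blast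
  next
    fix f f' r g g' s assume "(f, f', r) \<in> K" "(g, g', s) \<in> K"
    then show "f = g \<longleftrightarrow> f' = g'" using K_inj by fast
  next
    fix f f' r assume "(f, f', r) \<in> K"
    then show "f \<in> P \<and> f' \<in> P - W" using KP by fast
  next
    fix p assume "p \<in> P - W" then show "card (nb G' p) = 3" using card' by blast
  qed (use G W in blast)+
  show "cubic_graph G'" by (rule cubic')
  show "triangle_free G'" by (rule triangle_free')
  show "completable G' (P - W)" by (rule completable'[OF c])
  show "attached k G' (P - W)" if "attached k G P" by (rule attached'[OF that])
qed

lemma K23_startI:
  assumes "cubic_graph G" "triangle_free G" "u \<noteq> v" "nb G u = {x1, x2, x3}" "nb G v = {x1, x2, x3}"
    "completable G {u, v, x1, x2, x3}" "attached k G {u, v, x1, x2, x3}"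
  shows "K23_start k G"
proof -
  have e: "{u, v} \<union> nb G u = {u, v, x1, x2, x3}" using assms(4) by auto
  have "u \<in> verts G" using completable_subset[OF assms(6)] by blast
  then show ?thesis using assms e unfolding K23_start_def by metis
qed

lemma reduce_C1:
  assumes G: "cubic_graph G" "triangle_free G"
    and dist: "distinct [u, v, x1, x2, x3, y1, y2, y3, z]"
    and n: "nb G u = {x1, x2, x3}" "nb G v = {x1, x2, x3}" "nb G x1 = {u, v, y1}"
      "nb G x2 = {u, v, y2}" "nb G x3 = {u, v, y3}" "nb G y1 = {x1, z, s1}"
      "nb G y2 = {x2, z, s2}" "nb G y3 = {x3, z, s3}" "nb G z = {y1, y2, y3}"
    and out: "{s1, s2, s3} \<inter> {u, v, x1, x2, x3, y1, y2, y3, z} = {}"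
    and c: "completable G {u, v, x1, x2, x3, y1, y2, y3, z}"
    and a: "attached k G {u, v, x1, x2, x3, y1, y2, y3, z}"
  shows "reducible k C1 G"
proof -
  define W where "W = {y1, y2, y3, z}"
  define D where "D = {{x1, s1}, {x2, s2}, {x3, s3}}"
  define A where "A = {{x1, y1}, {x2, y2}, {x3, y3}, {y1, z}, {y2, z}, {y3, z}, {y1, s1}, {y2, s2},
      {y3, s3}}"
  \<comment> \<open>The edge from \<open>y1\<close> to \<open>s1\<close> becomes an edge from
    \<open>x1\<close> to \<open>s1\<close>, and likewise for the other indices. Coinciding
    \<open>si\<close> do no harm, since only the first two components are matched with each
    other.\<close>
  define K where "K = {(y1, x1, s1), (y2, x2, s2), (y3, x3, s3)}"
  define P where "P = {u, v, x1, x2, x3, y1, y2, y3, z}"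
  define G' where "G' = undo G W D A"
  \<comment> \<open>The simplifier needs every inequality in both orientations.\<close>
  have "distinct (rev [u, v, x1, x2, x3, y1, y2, y3, z])" using dist by (simp only: distinct_rev)
  moreover have "\<forall>r\<in>{s1, s2, s3}. \<forall>p\<in>P. r \<noteq> p \<and> p \<noteq> r"
    using out unfolding P_def by blast
  ultimately have "distinct [u, v, x1, x2, x3, y1, y2, y3, z] \<and> distinct (rev [u, v, x1, x2, x3, y1,
      y2, y3, z]) \<and>
    (\<forall>r\<in>{s1, s2, s3}. \<forall>p\<in>P. r \<noteq> p \<and> p \<noteq> r)"
    using dist by blast
  note ne = this[simplified P_def, simplified]
  have "{s1, s2, s3} \<subseteq> \<Union>(nb G ` P)" by (simp add: P_def n)
  also have "\<dots> \<subseteq> verts G" using cubicD(5)[OF G(1)] by (rule UN_least)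
  finally have V: "P \<union> {s1, s2, s3} \<subseteq> verts G"
    using completable_subset[OF c] unfolding P_def by (rule Un_least[rotated])
  have PW: "P - W = {u, v, x1, x2, x3}" by (auto simp: ne P_def W_def)
  have n': "nb G' u = {x1, x2, x3}" "nb G' v = {x1, x2, x3}" "nb G' x1 = {u, v, s1}"
      "nb G' x2 = {u, v, s2}" "nb G' x3 = {u, v, s3}"
    by (auto simp: ne G'_def nb_undo n A_def D_def doubleton_eq_iff)
  have W: "W \<subseteq> P" "W \<noteq> {}" "P - W \<noteq> {}" unfolding PW by (auto simp: W_def P_def)
  have A: "A \<subseteq> edges G" "\<forall>w\<in>W. \<forall>x\<in>nb G w. {w, x} \<in> A" "\<forall>e\<in>A. e \<inter> P \<noteq> {}"
    by (simp_all add: W_def A_def P_def edge_iff_nb n doubleton_eq_iff)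
  have D: "D \<inter> edges G = {}" "\<forall>e\<in>D. e \<subseteq> verts G - W \<and> card e = 2" "\<forall>e\<in>D. e \<inter> P \<noteq> {}"
    using V by (auto simp: ne D_def P_def W_def edge_iff_nb n)
  have P': "\<forall>p\<in>P - W. card (nb G' p) = 3"
    "\<forall>p\<in>P - W. \<forall>q\<in>nb G' p. q \<in> P - W \<longrightarrow> nb G' p \<inter> nb G' q = {}"
    unfolding PW by (simp_all add: ne n')
  have K: "\<forall>(f, f', r) \<in> K. f \<in> P \<and> f' \<in> P - W \<and> r \<notin> P \<and> r \<in> nb G f \<and> r \<in> nb G' f'"
    "\<forall>p\<in>P. \<forall>r\<in>nb G p. r \<in> P \<or> (\<exists>p'. (p, p', r) \<in> K)"
    "\<forall>p\<in>P - W. \<forall>r\<in>nb G' p. r \<in> P \<or> (\<exists>p0. (p0, p, r) \<in> K)"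
    "\<forall>(f, f', r) \<in> K. \<forall>(g, g', s) \<in> K. f = g \<longleftrightarrow> f' = g'"
    unfolding PW by (simp_all add: ne n n' P_def K_def)
  note S = undo_surgery[OF G'_def G W c[folded P_def] A D P' K]
  have "C1 G' G"
    unfolding C1_def
  proof (intro exI conjI)
    show "G = rewire G' {y1, y2, y3, z} {{x1, s1}, {x2, s2}, {x3, s3}}
      {{x1, y1}, {x2, y2}, {x3, y3}, {y1, z}, {y2, z}, {y3, z}, {y1, s1}, {y2, s2}, {y3, s3}}"
      using S(1) by (simp only: W_def D_def A_def)
    show "biclique {u, v} {x1, x2, x3} \<subseteq> edges G'"
      by (auto simp: biclique_def edge_iff_nb n')
    show "{{x1, s1}, {x2, s2}, {x3, s3}} \<subseteq> edges G'"
      by (simp add: edge_iff_nb n')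
    show "{y1, y2, y3, z} \<inter> verts G' = {}" by (auto simp: S(2) W_def)
  qed (simp_all add: ne)
  moreover have "K23_start k G'"
  proof (rule K23_startI[OF S(3,4)])
    show "completable G' {u, v, x1, x2, x3}" using S(5) unfolding PW .
    show "attached k G' {u, v, x1, x2, x3}" using S(6) a unfolding P_def[symmetric] PW .
  qed (use ne n' in auto)
  ultimately show ?thesis using S(7) unfolding reducible_def by blast
qed

lemma reduce_C2:
  assumes G: "cubic_graph G" "triangle_free G"
    and dist: "distinct [u, v, x1, x2, x3, y2, y3]"
    and n: "nb G u = {x1, x2, x3}" "nb G v = {x1, x2, x3}" "nb G x1 = {u, v, y1}"
      "nb G x2 = {u, v, y2}" "nb G x3 = {u, v, y3}" "nb G y2 = {x2, y3, s2}"
      "nb G y3 = {x3, y2, s3}"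
    and out: "{y1, s2, s3} \<inter> {u, v, x1, x2, x3, y2, y3} = {}"
    and c: "completable G {u, v, x1, x2, x3, y2, y3}"
    and a: "attached k G {u, v, x1, x2, x3, y2, y3}"
  shows "reducible k C2 G"
proof -
  define W where "W = {x2, x3}"
  define D where "D = {{u, y2}, {u, y3}, {v, y2}, {v, y3}}"
  define A where "A = {{u, x2}, {v, x2}, {u, x3}, {v, x3}, {x2, y2}, {x3, y3}, {y2, y3}}"
  \<comment> \<open>\<open>y2\<close> and \<open>y3\<close> keep their outside edges and take the
    places of \<open>x2\<close> and \<open>x3\<close> in the new
    \<open>K\<^sub>2\<^sub>,\<^sub>3\<close>.\<close>
  define K where "K = {(x1, x1, y1), (y2, y2, s2), (y3, y3, s3)}"
  define P where "P = {u, v, x1, x2, x3, y2, y3}"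
  define G' where "G' = undo G W D A"
  have "distinct (rev [u, v, x1, x2, x3, y2, y3])" using dist by (simp only: distinct_rev)
  moreover have "\<forall>r\<in>{y1, s2, s3}. \<forall>p\<in>P. r \<noteq> p \<and> p \<noteq> r"
    using out unfolding P_def by blast
  ultimately have "distinct [u, v, x1, x2, x3, y2, y3] \<and> distinct (rev [u, v, x1, x2, x3, y2, y3]) \<and>
    (\<forall>r\<in>{y1, s2, s3}. \<forall>p\<in>P. r \<noteq> p \<and> p \<noteq> r)"
    using dist by blast
  note ne = this[simplified P_def, simplified]
  have "{y1, s2, s3} \<subseteq> \<Union>(nb G ` P)" by (simp add: P_def n)
  also have "\<dots> \<subseteq> verts G" using cubicD(5)[OF G(1)] by (rule UN_least)
  finally have V: "P \<union> {y1, s2, s3} \<subseteq> verts G"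
    using completable_subset[OF c] unfolding P_def by (rule Un_least[rotated])
  have PW: "P - W = {u, v, x1, y2, y3}" by (auto simp: ne P_def W_def)
  have n': "nb G' u = {x1, y2, y3}" "nb G' v = {x1, y2, y3}" "nb G' x1 = {u, v, y1}"
      "nb G' y2 = {u, v, s2}" "nb G' y3 = {u, v, s3}"
    by (auto simp: ne G'_def nb_undo n A_def D_def doubleton_eq_iff)
  have W: "W \<subseteq> P" "W \<noteq> {}" "P - W \<noteq> {}" unfolding PW by (auto simp: W_def P_def)
  have A: "A \<subseteq> edges G" "\<forall>w\<in>W. \<forall>x\<in>nb G w. {w, x} \<in> A" "\<forall>e\<in>A. e \<inter> P \<noteq> {}"
    by (simp_all add: W_def A_def P_def edge_iff_nb n doubleton_eq_iff)
  have D: "D \<inter> edges G = {}" "\<forall>e\<in>D. e \<subseteq> verts G - W \<and> card e = 2" "\<forall>e\<in>D. e \<inter> P \<noteq> {}"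
    using V by (auto simp: ne D_def P_def W_def edge_iff_nb n)
  have P': "\<forall>p\<in>P - W. card (nb G' p) = 3"
    "\<forall>p\<in>P - W. \<forall>q\<in>nb G' p. q \<in> P - W \<longrightarrow> nb G' p \<inter> nb G' q = {}"
    unfolding PW by (simp_all add: ne n')
  have K: "\<forall>(f, f', r) \<in> K. f \<in> P \<and> f' \<in> P - W \<and> r \<notin> P \<and> r \<in> nb G f \<and> r \<in> nb G' f'"
    "\<forall>p\<in>P. \<forall>r\<in>nb G p. r \<in> P \<or> (\<exists>p'. (p, p', r) \<in> K)"
    "\<forall>p\<in>P - W. \<forall>r\<in>nb G' p. r \<in> P \<or> (\<exists>p0. (p0, p, r) \<in> K)"
    "\<forall>(f, f', r) \<in> K. \<forall>(g, g', s) \<in> K. f = g \<longleftrightarrow> f' = g'"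
    unfolding PW by (simp_all add: ne n n' P_def K_def)
  note S = undo_surgery[OF G'_def G W c[folded P_def] A D P' K]
  have "C2 G' G"
    unfolding C2_def
  proof (intro exI conjI)
    show "G = rewire G' {x2, x3} {{u, y2}, {u, y3}, {v, y2}, {v, y3}}
      {{u, x2}, {v, x2}, {u, x3}, {v, x3}, {x2, y2}, {x3, y3}, {y2, y3}}"
      using S(1) by (simp only: W_def D_def A_def)
    show "biclique {u, v} {x1, y2, y3} \<subseteq> edges G'"
      by (auto simp: biclique_def edge_iff_nb n')
    show "{x1, y1} \<in> edges G'"
      by (simp add: edge_iff_nb n')
    show "{x2, x3} \<inter> verts G' = {}" by (auto simp: S(2) W_def)
  qed (simp_all add: ne)
  moreover have "K23_start k G'"
  proof (rule K23_startI[OF S(3,4)])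
    show "completable G' {u, v, x1, y2, y3}" using S(5) unfolding PW .
    show "attached k G' {u, v, x1, y2, y3}" using S(6) a unfolding P_def[symmetric] PW .
  qed (use ne n' in auto)
  ultimately show ?thesis using S(7) unfolding reducible_def by blast
qed

lemma reduce_C3:
  assumes G: "cubic_graph G" "triangle_free G"
    and dist: "distinct [u, v, x1, x2, x3, y1, y2, w1, w2, w3, z]"
    and n: "nb G u = {x1, x2, x3}" "nb G v = {x1, x2, x3}" "nb G x1 = {u, v, y1}"
      "nb G x2 = {u, v, y2}" "nb G x3 = {u, v, y2}" "nb G y1 = {x1, w1, w2}"
      "nb G y2 = {x2, x3, w3}" "nb G w1 = {y1, z, s1}" "nb G w2 = {y1, z, s2}"
      "nb G w3 = {y2, z, s3}" "nb G z = {w1, w2, w3}"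
    and out: "{s1, s2, s3} \<inter> {u, v, x1, x2, x3, y1, y2, w1, w2, w3, z} = {}"
    and c: "completable G {u, v, x1, x2, x3, y1, y2, w1, w2, w3, z}"
    and a: "attached k G {u, v, x1, x2, x3, y1, y2, w1, w2, w3, z}"
  shows "reducible k C3 G"
proof -
  define W where "W = {y1, y2, w1, w2, w3, z}"
  define D where "D = {{x1, s1}, {x2, s2}, {x3, s3}}"
  define A where "A = {{x1, y1}, {x2, y2}, {x3, y2}, {y1, w1}, {y1, w2}, {y2, w3}, {z, w1}, {z, w2},
      {z, w3}, {w1, s1}, {w2, s2}, {w3, s3}}"
  define K where "K = {(w1, x1, s1), (w2, x2, s2), (w3, x3, s3)}"
  define P where "P = {u, v, x1, x2, x3, y1, y2, w1, w2, w3, z}"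
  define G' where "G' = undo G W D A"
  have "distinct (rev [u, v, x1, x2, x3, y1, y2, w1, w2, w3, z])" using dist by (simp only:
      distinct_rev)
  moreover have "\<forall>r\<in>{s1, s2, s3}. \<forall>p\<in>P. r \<noteq> p \<and> p \<noteq> r"
    using out unfolding P_def by blast
  ultimately have "distinct [u, v, x1, x2, x3, y1, y2, w1, w2, w3, z] \<and> distinct (rev [u, v, x1, x2,
      x3, y1, y2, w1, w2, w3, z]) \<and>
    (\<forall>r\<in>{s1, s2, s3}. \<forall>p\<in>P. r \<noteq> p \<and> p \<noteq> r)"
    using dist by blast
  note ne = this[simplified P_def, simplified]
  have "{s1, s2, s3} \<subseteq> \<Union>(nb G ` P)" by (simp add: P_def n)
  also have "\<dots> \<subseteq> verts G" using cubicD(5)[OF G(1)] by (rule UN_least)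
  finally have V: "P \<union> {s1, s2, s3} \<subseteq> verts G"
    using completable_subset[OF c] unfolding P_def by (rule Un_least[rotated])
  have PW: "P - W = {u, v, x1, x2, x3}" by (auto simp: ne P_def W_def)
  have n': "nb G' u = {x1, x2, x3}" "nb G' v = {x1, x2, x3}" "nb G' x1 = {u, v, s1}"
      "nb G' x2 = {u, v, s2}" "nb G' x3 = {u, v, s3}"
    by (auto simp: ne G'_def nb_undo n A_def D_def doubleton_eq_iff)
  have W: "W \<subseteq> P" "W \<noteq> {}" "P - W \<noteq> {}" unfolding PW by (auto simp: W_def P_def)
  have A: "A \<subseteq> edges G" "\<forall>w\<in>W. \<forall>x\<in>nb G w. {w, x} \<in> A" "\<forall>e\<in>A. e \<inter> P \<noteq> {}"
    by (simp_all add: W_def A_def P_def edge_iff_nb n doubleton_eq_iff)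
  have D: "D \<inter> edges G = {}" "\<forall>e\<in>D. e \<subseteq> verts G - W \<and> card e = 2" "\<forall>e\<in>D. e \<inter> P \<noteq> {}"
    using V by (auto simp: ne D_def P_def W_def edge_iff_nb n)
  have P': "\<forall>p\<in>P - W. card (nb G' p) = 3"
    "\<forall>p\<in>P - W. \<forall>q\<in>nb G' p. q \<in> P - W \<longrightarrow> nb G' p \<inter> nb G' q = {}"
    unfolding PW by (simp_all add: ne n')
  have K: "\<forall>(f, f', r) \<in> K. f \<in> P \<and> f' \<in> P - W \<and> r \<notin> P \<and> r \<in> nb G f \<and> r \<in> nb G' f'"
    "\<forall>p\<in>P. \<forall>r\<in>nb G p. r \<in> P \<or> (\<exists>p'. (p, p', r) \<in> K)"
    "\<forall>p\<in>P - W. \<forall>r\<in>nb G' p. r \<in> P \<or> (\<exists>p0. (p0, p, r) \<in> K)"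
    "\<forall>(f, f', r) \<in> K. \<forall>(g, g', s) \<in> K. f = g \<longleftrightarrow> f' = g'"
    unfolding PW by (simp_all add: ne n n' P_def K_def)
  note S = undo_surgery[OF G'_def G W c[folded P_def] A D P' K]
  have "C3 G' G"
    unfolding C3_def
  proof (intro exI conjI)
    show "G = rewire G' {y1, y2, w1, w2, w3, z} {{x1, s1}, {x2, s2}, {x3, s3}}
      {{x1, y1}, {x2, y2}, {x3, y2}, {y1, w1}, {y1, w2}, {y2, w3}, {z, w1}, {z, w2}, {z, w3}, {w1,
          s1}, {w2, s2}, {w3, s3}}"
      using S(1) by (simp only: W_def D_def A_def)
    show "biclique {u, v} {x1, x2, x3} \<subseteq> edges G'"
      by (auto simp: biclique_def edge_iff_nb n')
    show "{{x1, s1}, {x2, s2}, {x3, s3}} \<subseteq> edges G'"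
      by (simp add: edge_iff_nb n')
    show "{y1, y2, w1, w2, w3, z} \<inter> verts G' = {}" by (auto simp: S(2) W_def)
  qed (simp_all add: ne)
  moreover have "K23_start k G'"
  proof (rule K23_startI[OF S(3,4)])
    show "completable G' {u, v, x1, x2, x3}" using S(5) unfolding PW .
    show "attached k G' {u, v, x1, x2, x3}" using S(6) a unfolding P_def[symmetric] PW .
  qed (use ne n' in auto)
  ultimately show ?thesis using S(7) unfolding reducible_def by blast
qed

lemma reduce_C4:
  assumes G: "cubic_graph G" "triangle_free G"
    and dist: "distinct [u, v, x1, x2, x3, y1, y2, w2, w3]"
    and n: "nb G u = {x1, x2, x3}" "nb G v = {x1, x2, x3}" "nb G x1 = {u, v, y1}"
      "nb G x2 = {u, v, y2}" "nb G x3 = {u, v, y2}" "nb G y1 = {x1, w1, w2}"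
      "nb G y2 = {x2, x3, w3}" "nb G w2 = {y1, w3, s2}" "nb G w3 = {y2, w2, s3}"
    and out: "{w1, s2, s3} \<inter> {u, v, x1, x2, x3, y1, y2, w2, w3} = {}"
    and c: "completable G {u, v, x1, x2, x3, y1, y2, w2, w3}"
    and a: "attached k G {u, v, x1, x2, x3, y1, y2, w2, w3}"
  shows "reducible k C4 G"
proof -
  define W where "W = {x2, x3, y1, y2}"
  define D where "D = {{x1, w1}, {u, w2}, {u, w3}, {v, w2}, {v, w3}}"
  define A where "A = {{u, x2}, {v, x2}, {u, x3}, {v, x3}, {x2, y2}, {x3, y2}, {x1, y1}, {y1, w1},
      {y1, w2}, {y2, w3}, {w2, w3}}"
  \<comment> \<open>\<open>x1\<close> takes over the outside edge of \<open>y1\<close>;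
    \<open>w2\<close> and \<open>w3\<close> keep theirs and replace \<open>x2\<close> and
    \<open>x3\<close>.\<close>
  define K where "K = {(y1, x1, w1), (w2, w2, s2), (w3, w3, s3)}"
  define P where "P = {u, v, x1, x2, x3, y1, y2, w2, w3}"
  define G' where "G' = undo G W D A"
  have "distinct (rev [u, v, x1, x2, x3, y1, y2, w2, w3])" using dist by (simp only: distinct_rev)
  moreover have "\<forall>r\<in>{w1, s2, s3}. \<forall>p\<in>P. r \<noteq> p \<and> p \<noteq> r"
    using out unfolding P_def by blast
  ultimately have "distinct [u, v, x1, x2, x3, y1, y2, w2, w3] \<and> distinct (rev [u, v, x1, x2, x3,
      y1, y2, w2, w3]) \<and>
    (\<forall>r\<in>{w1, s2, s3}. \<forall>p\<in>P. r \<noteq> p \<and> p \<noteq> r)"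
    using dist by blast
  note ne = this[simplified P_def, simplified]
  have "{w1, s2, s3} \<subseteq> \<Union>(nb G ` P)" by (simp add: P_def n)
  also have "\<dots> \<subseteq> verts G" using cubicD(5)[OF G(1)] by (rule UN_least)
  finally have V: "P \<union> {w1, s2, s3} \<subseteq> verts G"
    using completable_subset[OF c] unfolding P_def by (rule Un_least[rotated])
  have PW: "P - W = {u, v, x1, w2, w3}" by (auto simp: ne P_def W_def)
  have n': "nb G' u = {x1, w2, w3}" "nb G' v = {x1, w2, w3}" "nb G' x1 = {u, v, w1}"
      "nb G' w2 = {u, v, s2}" "nb G' w3 = {u, v, s3}"
    by (auto simp: ne G'_def nb_undo n A_def D_def doubleton_eq_iff)
  have W: "W \<subseteq> P" "W \<noteq> {}" "P - W \<noteq> {}" unfolding PW by (auto simp: W_def P_def)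
  have A: "A \<subseteq> edges G" "\<forall>w\<in>W. \<forall>x\<in>nb G w. {w, x} \<in> A" "\<forall>e\<in>A. e \<inter> P \<noteq> {}"
    by (simp_all add: W_def A_def P_def edge_iff_nb n doubleton_eq_iff)
  have D: "D \<inter> edges G = {}" "\<forall>e\<in>D. e \<subseteq> verts G - W \<and> card e = 2" "\<forall>e\<in>D. e \<inter> P \<noteq> {}"
    using V by (auto simp: ne D_def P_def W_def edge_iff_nb n)
  have P': "\<forall>p\<in>P - W. card (nb G' p) = 3"
    "\<forall>p\<in>P - W. \<forall>q\<in>nb G' p. q \<in> P - W \<longrightarrow> nb G' p \<inter> nb G' q = {}"
    unfolding PW by (simp_all add: ne n')
  have K: "\<forall>(f, f', r) \<in> K. f \<in> P \<and> f' \<in> P - W \<and> r \<notin> P \<and> r \<in> nb G f \<and> r \<in> nb G' f'"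
    "\<forall>p\<in>P. \<forall>r\<in>nb G p. r \<in> P \<or> (\<exists>p'. (p, p', r) \<in> K)"
    "\<forall>p\<in>P - W. \<forall>r\<in>nb G' p. r \<in> P \<or> (\<exists>p0. (p0, p, r) \<in> K)"
    "\<forall>(f, f', r) \<in> K. \<forall>(g, g', s) \<in> K. f = g \<longleftrightarrow> f' = g'"
    unfolding PW by (simp_all add: ne n n' P_def K_def)
  note S = undo_surgery[OF G'_def G W c[folded P_def] A D P' K]
  have "C4 G' G"
    unfolding C4_def
  proof (intro exI conjI)
    show "G = rewire G' {x2, x3, y1, y2} {{x1, w1}, {u, w2}, {u, w3}, {v, w2}, {v, w3}}
      {{u, x2}, {v, x2}, {u, x3}, {v, x3}, {x2, y2}, {x3, y2}, {x1, y1}, {y1, w1}, {y1, w2}, {y2,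
          w3}, {w2, w3}}"
      using S(1) by (simp only: W_def D_def A_def)
    show "biclique {u, v} {x1, w2, w3} \<subseteq> edges G'"
      by (auto simp: biclique_def edge_iff_nb n')
    show "{x1, w1} \<in> edges G'"
      by (simp add: edge_iff_nb n')
    show "{x2, x3, y1, y2} \<inter> verts G' = {}" by (auto simp: S(2) W_def)
  qed (simp_all add: ne)
  moreover have "K23_start k G'"
  proof (rule K23_startI[OF S(3,4)])
    show "completable G' {u, v, x1, w2, w3}" using S(5) unfolding PW .
    show "attached k G' {u, v, x1, w2, w3}" using S(6) a unfolding P_def[symmetric] PW .
  qed (use ne n' in auto)
  ultimately show ?thesis using S(7) unfolding reducible_def by blast
qed

lemma reduce_C5:
  assumes G: "cubic_graph G" "triangle_free G"
    and dist: "distinct [u, v, x1, x2, x3, y, p, q]"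
    and n: "nb G u = {x1, x2, x3}" "nb G v = {x1, x2, x3}" "nb G x1 = {u, v, p}"
      "nb G x2 = {u, v, y}" "nb G x3 = {u, v, y}" "nb G y = {x2, x3, q}"
      "nb G p = {x1, q, s}" "nb G q = {y, p, t}"
    and out: "{s, t} \<inter> {u, v, x1, x2, x3, y, p, q} = {}"
    and ex: "s \<noteq> t"
    and c: "completable G {u, v, x1, x2, x3, y, p, q}"
    and a: "attached 1 G {u, v, x1, x2, x3, y, p, q}"
  shows "reducible 1 C5 G"
proof -
  define W where "W = {p, q}"
  define D where "D = {{x1, s}, {y, t}}"
  define A where "A = {{x1, p}, {p, s}, {y, q}, {q, t}, {p, q}}"
  define K where "K = {(p, x1, s), (q, y, t)}"
  define P where "P = {u, v, x1, x2, x3, y, p, q}"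
  define G' where "G' = undo G W D A"
  have "distinct (rev [u, v, x1, x2, x3, y, p, q])" using dist by (simp only: distinct_rev)
  moreover have "\<forall>r\<in>{s, t}. \<forall>p\<in>P. r \<noteq> p \<and> p \<noteq> r"
    using out unfolding P_def by blast
  ultimately have "distinct [u, v, x1, x2, x3, y, p, q] \<and> distinct (rev [u, v, x1, x2, x3, y, p, q])
      \<and>
    (\<forall>r\<in>{s, t}. \<forall>p\<in>P. r \<noteq> p \<and> p \<noteq> r)"
    using dist by blast
  note ne = this[simplified P_def, simplified] ex
  have "{s, t} \<subseteq> \<Union>(nb G ` P)" by (simp add: P_def n)
  also have "\<dots> \<subseteq> verts G" using cubicD(5)[OF G(1)] by (rule UN_least)
  finally have V: "P \<union> {s, t} \<subseteq> verts G"
    using completable_subset[OF c] unfolding P_def by (rule Un_least[rotated])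
  have PW: "P - W = {u, v, x1, x2, x3, y}" by (auto simp: ne P_def W_def)
  have n': "nb G' u = {x1, x2, x3}" "nb G' v = {x1, x2, x3}" "nb G' x1 = {u, v, s}"
      "nb G' x2 = {u, v, y}" "nb G' x3 = {u, v, y}" "nb G' y = {x2, x3, t}"
    by (auto simp: ne G'_def nb_undo n A_def D_def doubleton_eq_iff)
  have W: "W \<subseteq> P" "W \<noteq> {}" "P - W \<noteq> {}" unfolding PW by (auto simp: W_def P_def)
  have A: "A \<subseteq> edges G" "\<forall>w\<in>W. \<forall>x\<in>nb G w. {w, x} \<in> A" "\<forall>e\<in>A. e \<inter> P \<noteq> {}"
    by (simp_all add: W_def A_def P_def edge_iff_nb n doubleton_eq_iff)
  have D: "D \<inter> edges G = {}" "\<forall>e\<in>D. e \<subseteq> verts G - W \<and> card e = 2" "\<forall>e\<in>D. e \<inter> P \<noteq> {}"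
    using V by (auto simp: ne D_def P_def W_def edge_iff_nb n)
  have P': "\<forall>p\<in>P - W. card (nb G' p) = 3"
    "\<forall>p\<in>P - W. \<forall>q\<in>nb G' p. q \<in> P - W \<longrightarrow> nb G' p \<inter> nb G' q = {}"
    unfolding PW by (simp_all add: ne n')
  have K: "\<forall>(f, f', r) \<in> K. f \<in> P \<and> f' \<in> P - W \<and> r \<notin> P \<and> r \<in> nb G f \<and> r \<in> nb G' f'"
    "\<forall>p\<in>P. \<forall>r\<in>nb G p. r \<in> P \<or> (\<exists>p'. (p, p', r) \<in> K)"
    "\<forall>p\<in>P - W. \<forall>r\<in>nb G' p. r \<in> P \<or> (\<exists>p0. (p0, p, r) \<in> K)"
    "\<forall>(f, f', r) \<in> K. \<forall>(g, g', s) \<in> K. f = g \<longleftrightarrow> f' = g'"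
    unfolding PW by (simp_all add: ne n n' P_def K_def)
  note S = undo_surgery[OF G'_def G W c[folded P_def] A D P' K]
  have "C5 G' G"
    unfolding C5_def
  proof (intro exI conjI)
    show "G = rewire G' {p, q} {{x1, s}, {y, t}}
      {{x1, p}, {p, s}, {y, q}, {q, t}, {p, q}}"
      using S(1) by (simp only: W_def D_def A_def)
    show "biclique {u, v} {x1, x2, x3} \<subseteq> edges G'"
      by (auto simp: biclique_def edge_iff_nb n')
    show "{{x2, y}, {x3, y}, {x1, s}, {y, t}} \<subseteq> edges G'"
      by (simp add: edge_iff_nb n')
    show "{p, q} \<inter> verts G' = {}" by (auto simp: S(2) W_def)
  qed (simp_all add: ne)
  moreover have "K23_start 1 G'"
  proof (rule K23_startI[OF S(3,4)])
    let ?P5 = "{u, v, x1, x2, x3}"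
    \<comment> \<open>Removing \<open>p\<close> and \<open>q\<close> leaves one vertex more than the
      \<open>K\<^sub>2\<^sub>,\<^sub>3\<close>, so \<open>y\<close> is released from the segment
      afterwards.\<close>
    have e: "P - W = insert y ?P5" unfolding PW by auto
    have "bd G' (insert y ?P5) \<subseteq> {x1, y, y}"
      by (auto simp: bd_def n')
    then have c1: "completable G' ?P5"
      using S(5)[unfolded e] by (rule completable_down[rotated 2]) (simp add: ne)
    then show "completable G' ?P5" .
    have a2: "attached 1 G' (insert y ?P5)" using S(6) a unfolding P_def[symmetric] e .
    have a1: "attached 1 G' ?P5"
      by (rule attached_down[OF a2 S(3), of x2]) (simp_all add: n')
    then show "attached 1 G' ?P5" .
  qed (use ne n' in auto)
  ultimately show ?thesis using S(7) unfolding reducible_def by blast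
qed

text \<open>The segment has to include \<open>s\<close> and \<open>t\<close>. If it ended at
  \<open>q\<close>, the two outside edges of the single vertex \<open>q\<close> would be distributed
  to the two vertices \<open>x1\<close> and \<open>y\<close>, which \<open>K_inj\<close>
  excludes.\<close>

lemma reduce_C6:
  assumes G: "cubic_graph G" "triangle_free G"
    and dist: "distinct [u, v, x1, x2, x3, y, p, q, s, t]"
    and n: "nb G u = {x1, x2, x3}" "nb G v = {x1, x2, x3}" "nb G x1 = {u, v, p}"
      "nb G x2 = {u, v, y}" "nb G x3 = {u, v, y}" "nb G y = {x2, x3, p}"
      "nb G p = {x1, y, q}" "nb G q = {p, s, t}" "nb G s = {q, s1, s2}"
      "nb G t = {q, t1, t2}"
    and out: "{s1, s2, t1, t2} \<inter> {u, v, x1, x2, x3, y, p, q, s, t} = {}"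
    and ex: "s1 \<noteq> s2 \<and> t1 \<noteq> t2"
    and c: "completable G {u, v, x1, x2, x3, y, p, q, s, t}"
    and a: "attached 1 G {u, v, x1, x2, x3, y, p, q, s, t}"
  shows "reducible 1 C6 G"
proof -
  define W where "W = {p, q}"
  define D where "D = {{x1, s}, {y, t}}"
  define A where "A = {{x1, p}, {y, p}, {p, q}, {q, s}, {q, t}}"
  define K where "K = {(s, s, s1), (s, s, s2), (t, t, t1), (t, t, t2)}"
  define P where "P = {u, v, x1, x2, x3, y, p, q, s, t}"
  define G' where "G' = undo G W D A"
  have "distinct (rev [u, v, x1, x2, x3, y, p, q, s, t])" using dist by (simp only: distinct_rev)
  moreover have "\<forall>r\<in>{s1, s2, t1, t2}. \<forall>p\<in>P. r \<noteq> p \<and> p \<noteq> r"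
    using out unfolding P_def by blast
  ultimately have "distinct [u, v, x1, x2, x3, y, p, q, s, t] \<and> distinct (rev [u, v, x1, x2, x3, y,
      p, q, s, t]) \<and>
    (\<forall>r\<in>{s1, s2, t1, t2}. \<forall>p\<in>P. r \<noteq> p \<and> p \<noteq> r)"
    using dist by blast
  note ne = this[simplified P_def, simplified] ex
  have "{s1, s2, t1, t2} \<subseteq> \<Union>(nb G ` P)" by (simp add: P_def n)
  also have "\<dots> \<subseteq> verts G" using cubicD(5)[OF G(1)] by (rule UN_least)
  finally have V: "P \<union> {s1, s2, t1, t2} \<subseteq> verts G"
    using completable_subset[OF c] unfolding P_def by (rule Un_least[rotated])
  have PW: "P - W = {u, v, x1, x2, x3, y, s, t}" by (auto simp: ne P_def W_def)
  have n': "nb G' u = {x1, x2, x3}" "nb G' v = {x1, x2, x3}" "nb G' x1 = {u, v, s}"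
      "nb G' x2 = {u, v, y}" "nb G' x3 = {u, v, y}" "nb G' y = {x2, x3, t}"
      "nb G' s = {x1, s1, s2}" "nb G' t = {y, t1, t2}"
    by (auto simp: ne G'_def nb_undo n A_def D_def doubleton_eq_iff)
  have W: "W \<subseteq> P" "W \<noteq> {}" "P - W \<noteq> {}" unfolding PW by (auto simp: W_def P_def)
  have A: "A \<subseteq> edges G" "\<forall>w\<in>W. \<forall>x\<in>nb G w. {w, x} \<in> A" "\<forall>e\<in>A. e \<inter> P \<noteq> {}"
    by (simp_all add: W_def A_def P_def edge_iff_nb n doubleton_eq_iff)
  have D: "D \<inter> edges G = {}" "\<forall>e\<in>D. e \<subseteq> verts G - W \<and> card e = 2" "\<forall>e\<in>D. e \<inter> P \<noteq> {}"
    using V by (auto simp: ne D_def P_def W_def edge_iff_nb n)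
  have P': "\<forall>p\<in>P - W. card (nb G' p) = 3"
    "\<forall>p\<in>P - W. \<forall>q\<in>nb G' p. q \<in> P - W \<longrightarrow> nb G' p \<inter> nb G' q = {}"
    unfolding PW by (simp_all add: ne n')
  have K: "\<forall>(f, f', r) \<in> K. f \<in> P \<and> f' \<in> P - W \<and> r \<notin> P \<and> r \<in> nb G f \<and> r \<in> nb G' f'"
    "\<forall>p\<in>P. \<forall>r\<in>nb G p. r \<in> P \<or> (\<exists>p'. (p, p', r) \<in> K)"
    "\<forall>p\<in>P - W. \<forall>r\<in>nb G' p. r \<in> P \<or> (\<exists>p0. (p0, p, r) \<in> K)"
    "\<forall>(f, f', r) \<in> K. \<forall>(g, g', s) \<in> K. f = g \<longleftrightarrow> f' = g'"
    unfolding PW by (simp_all add: ne n n' P_def K_def) blast+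
  note S = undo_surgery[OF G'_def G W c[folded P_def] A D P' K]
  have "C6 G' G"
    unfolding C6_def
  proof (intro exI conjI)
    show "G = rewire G' {p, q} {{x1, s}, {y, t}}
      {{x1, p}, {y, p}, {p, q}, {q, s}, {q, t}}"
      using S(1) by (simp only: W_def D_def A_def)
    show "biclique {u, v} {x1, x2, x3} \<subseteq> edges G'"
      by (auto simp: biclique_def edge_iff_nb n')
    show "{{x2, y}, {x3, y}, {x1, s}, {y, t}} \<subseteq> edges G'"
      by (simp add: edge_iff_nb n')
    show "{p, q} \<inter> verts G' = {}" by (auto simp: S(2) W_def)
  qed (simp_all add: ne)
  moreover have "K23_start 1 G'"
  proof (rule K23_startI[OF S(3,4)])
    let ?P5 = "{u, v, x1, x2, x3}"
    \<comment> \<open>\<open>t\<close>, \<open>s\<close> and \<open>y\<close> are released one after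
      the other until only the \<open>K\<^sub>2\<^sub>,\<^sub>3\<close> is left.\<close>
    have e: "P - W = insert t (insert s (insert y ?P5))" unfolding PW by auto
    have "bd G' (insert t (insert s (insert y ?P5))) \<subseteq> {s, t, t}"
      by (auto simp: bd_def n')
    then have c3: "completable G' (insert s (insert y ?P5))"
      using S(5)[unfolded e] by (rule completable_down[rotated 2]) (simp add: ne)
    have "bd G' (insert s (insert y ?P5)) \<subseteq> {s, y, y}"
      by (auto simp: bd_def n')
    then have c2: "completable G' (insert y ?P5)"
      using c3 by (rule completable_down[rotated 2]) (simp add: ne)
    have "bd G' (insert y ?P5) \<subseteq> {x1, y, y}"
      by (auto simp: bd_def n')
    then have c1: "completable G' ?P5"
      using c2 by (rule completable_down[rotated 2]) (simp add: ne)
    then show "completable G' ?P5" .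
    have a4: "attached 1 G' (insert t (insert s (insert y ?P5)))" using S(6) a unfolding
        P_def[symmetric] e .
    have a3: "attached 1 G' (insert s (insert y ?P5))"
      by (rule attached_down[OF a4 S(3), of y]) (simp_all add: n')
    have a2: "attached 1 G' (insert y ?P5)"
      by (rule attached_down[OF a3 S(3), of x1]) (simp_all add: n')
    have a1: "attached 1 G' ?P5"
      by (rule attached_down[OF a2 S(3), of x2]) (simp_all add: n')
    then show "attached 1 G' ?P5" .
  qed (use ne n' in auto)
  ultimately show ?thesis using S(7) unfolding reducible_def by blast
qed

section \<open>Three distinct third neighbours\<close>

text \<open>\<open>s2\<close> and \<open>s3\<close> are absorbed through \<open>x2\<close> and
  \<open>x3\<close>. Together with the edge between them, the seven vertices are the outcome of a
  \<open>C2\<close> step whose \<open>y2\<close> and \<open>y3\<close> are \<open>s2\<close> and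
  \<open>s3\<close>.\<close>

lemma adjacent_third_C2:
  assumes G: "cubic_graph G" "triangle_free G"
    and dist: "distinct [u, v, x1, x2, x3]" "distinct [s1, s2, s3]"
    and n: "nb G u = {x1, x2, x3}" "nb G v = {x1, x2, x3}"
      "nb G x1 = {u, v, s1}" "nb G x2 = {u, v, s2}" "nb G x3 = {u, v, s3}"
    and out: "{s1, s2, s3} \<inter> {u, v, x1, x2, x3} = {}"
    and adj: "s3 \<in> nb G s2"
    and c: "completable G {u, v, x1, x2, x3}" and a: "attached k G {u, v, x1, x2, x3}"
  shows "reducible k C2 G"
proof -
  have s: "x2 \<in> nb G s2" "x3 \<in> nb G s3" "s2 \<in> nb G s3" by (rule nb_symD, use n adj in simp)+
  obtain c2 where c2: "nb G s2 = {x2, s3, c2}" "c2 \<noteq> x2" "c2 \<noteq> s3"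
    using nb_third[OF G(1), of x2 s3 s2] s adj out by auto
  obtain c3 where c3: "nb G s3 = {x3, s2, c3}" "c3 \<noteq> x3" "c3 \<noteq> s2"
    using nb_third[OF G(1), of x3 s2 s3] s adj out by auto
  have c': "s2 \<in> nb G c2" "s3 \<in> nb G c3" by (rule nb_symD, simp add: c2(1) c3(1))+
  have irr: "s2 \<notin> nb G s2" "s3 \<notin> nb G s3" using cubicD(6)[OF G(1)] by blast+
  have "c2 \<notin> {u, v, x1, x3}" "c3 \<notin> {u, v, x1, x2}"
    using c' dist out by (auto simp: n)
  then have out': "{s1, c2, c3} \<inter> {u, v, x1, x2, x3, s2, s3} = {}"
    using c2 c3 irr out dist by auto
  have "completable G (insert s2 {u, v, x1, x2, x3})"
    by (rule completable_absorb[OF c G(1), of x2]) (use out n in auto)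
  then have "completable G (insert s3 (insert s2 {u, v, x1, x2, x3}))"
    by (rule completable_absorb[OF _ G(1), of _ x3]) (use out n dist in auto)
  moreover have e: "insert s3 (insert s2 {u, v, x1, x2, x3}) = {u, v, x1, x2, x3, s2, s3}" by auto
  ultimately show ?thesis
    using reduce_C2[OF G _ n c2(1) c3(1) out'] attached_mono[OF a, of "{u, v, x1, x2, x3, s2, s3}"]
      dist out by auto
qed

text \<open>Once the \<open>si\<close> are absorbed, they form the whole boundary and each has two
  outside neighbours, so \<open>completable_cap\<close> yields the vertex \<open>z\<close> of a
  \<open>C1\<close> step whose \<open>yi\<close> are the \<open>si\<close>.\<close>

lemma independent_thirds_C1:
  assumes G: "cubic_graph G" "triangle_free G"
    and dist: "distinct [u, v, x1, x2, x3]" "distinct [s1, s2, s3]"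
    and n: "nb G u = {x1, x2, x3}" "nb G v = {x1, x2, x3}"
      "nb G x1 = {u, v, s1}" "nb G x2 = {u, v, s2}" "nb G x3 = {u, v, s3}"
    and out: "{s1, s2, s3} \<inter> {u, v, x1, x2, x3} = {}"
    and adj: "s2 \<notin> nb G s1" "s3 \<notin> nb G s1" "s3 \<notin> nb G s2"
    and c: "completable G {u, v, x1, x2, x3}" and a: "attached k G {u, v, x1, x2, x3}"
  shows "reducible k C1 G"
proof -
  let ?P5 = "{u, v, x1, x2, x3}"
  let ?P = "{u, v, x1, x2, x3, s1, s2, s3}"
  have s: "x1 \<in> nb G s1" "x2 \<in> nb G s2" "x3 \<in> nb G s3" by (rule nb_symD, simp add: n)+
  have irr: "s1 \<notin> nb G s1" "s2 \<notin> nb G s2" "s3 \<notin> nb G s3" using cubicD(6)[OF G(1)] by blast+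
  have adj': "s1 \<notin> nb G s2" "s1 \<notin> nb G s3" "s2 \<notin> nb G s3" by (use adj nb_symD in metis)+
  have ux: "s1 \<notin> nb G p" if "p \<in> {u, v, x2, x3}" for p using that out dist by (auto simp: n)
  have vx: "s2 \<notin> nb G p" if "p \<in> {u, v, x1, x3}" for p using that out dist by (auto simp: n)
  have wx: "s3 \<notin> nb G p" if "p \<in> {u, v, x1, x2}" for p using that out dist by (auto simp: n)
  have out1: "c \<notin> ?P" if "c \<in> nb G s1" "c \<noteq> x1" for c
    using nb_symD[OF that(1)] that ux[of c] irr adj by auto
  have out2: "c \<notin> ?P" if "c \<in> nb G s2" "c \<noteq> x2" for c
    using nb_symD[OF that(1)] that vx[of c] irr adj adj' by auto
  have out3: "c \<notin> ?P" if "c \<in> nb G s3" "c \<noteq> x3" for c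
    using nb_symD[OF that(1)] that wx[of c] irr adj' by auto
  have "completable G (insert s1 ?P5)"
    by (rule completable_absorb[OF c G(1), of x1]) (use out n in auto)
  then have "completable G (insert s2 (insert s1 ?P5))"
    by (rule completable_absorb[OF _ G(1), of _ x2]) (use out n dist in auto)
  then have "completable G (insert s3 (insert s2 (insert s1 ?P5)))"
    by (rule completable_absorb[OF _ G(1), of _ x3]) (use out n dist in auto)
  moreover have "insert s3 (insert s2 (insert s1 ?P5)) = ?P" by auto
  ultimately have c8: "completable G ?P" by simp
  obtain z where z: "z \<notin> ?P" "nb G z = {s1, s2, s3}" "completable G (insert z ?P)"
  proof (rule completable_cap[OF c8 G(1) dist(2)])
    show "\<not> nb G f \<subseteq> insert w ?P" if "f \<in> {s1, s2, s3}" for f w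
      using that two_outside[OF G(1) s(1), of ?P w] two_outside[OF G(1) s(2), of ?P w]
        two_outside[OF G(1) s(3), of ?P w] out1 out2 out3 by blast
    show "nb G p \<subseteq> ?P" if "p \<in> ?P" "p \<notin> {s1, s2, s3}" for p
      using that by (auto simp: n)
  qed auto
  have zs: "z \<in> nb G s1" "z \<in> nb G s2" "z \<in> nb G s3" by (rule nb_symD, simp add: z(2))+
  obtain t1 where t1: "nb G s1 = {x1, z, t1}" "t1 \<noteq> x1" "t1 \<noteq> z"
    using nb_third[OF G(1), of x1 z s1] s zs z(1) by auto
  obtain t2 where t2: "nb G s2 = {x2, z, t2}" "t2 \<noteq> x2" "t2 \<noteq> z"
    using nb_third[OF G(1), of x2 z s2] s zs z(1) by auto
  obtain t3 where t3: "nb G s3 = {x3, z, t3}" "t3 \<noteq> x3" "t3 \<noteq> z"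
    using nb_third[OF G(1), of x3 z s3] s zs z(1) by auto
  have "{t1, t2, t3} \<inter> ?P = {}"
    using out1[of t1] out2[of t2] out3[of t3] t1 t2 t3 by blast
  then have out': "{t1, t2, t3} \<inter> {u, v, x1, x2, x3, s1, s2, s3, z} = {}"
    using t1 t2 t3 by blast
  have e: "insert z ?P = {u, v, x1, x2, x3, s1, s2, s3, z}" by auto
  have d: "distinct [u, v, x1, x2, x3, s1, s2, s3, z]" using dist out z(1) by auto
  show ?thesis
    using reduce_C1[OF G d n t1(1) t2(1) t3(1) z(2) out' z(3)[unfolded e]]
      attached_mono[OF a, of "{u, v, x1, x2, x3, s1, s2, s3, z}"] by blast
qed

lemma distinct_thirds:
  assumes G: "cubic_graph G" "triangle_free G"
    and dist: "distinct [u, v, x1, x2, x3]" "distinct [s1, s2, s3]"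
    and n: "nb G u = {x1, x2, x3}" "nb G v = {x1, x2, x3}"
      "nb G x1 = {u, v, s1}" "nb G x2 = {u, v, s2}" "nb G x3 = {u, v, s3}"
    and out: "{s1, s2, s3} \<inter> {u, v, x1, x2, x3} = {}"
    and c: "completable G {u, v, x1, x2, x3}" and a: "attached k G {u, v, x1, x2, x3}"
  shows "reducible k C1 G \<or> reducible k C2 G"
proof -
  \<comment> \<open>Permuting the indices brings any adjacent pair of third neighbours into the last
    two positions, as \<open>adjacent_third_C2\<close> expects.\<close>
  have e: "{x3, x1, x2} = {x1, x2, x3}" "{x2, x1, x3} = {x1, x2, x3}"
    "{u, v, x3, x1, x2} = {u, v, x1, x2, x3}" "{u, v, x2, x1, x3} = {u, v, x1, x2, x3}"
    by auto
  have d: "distinct [u, v, x3, x1, x2]" "distinct [u, v, x2, x1, x3]"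
    "distinct [s3, s1, s2]" "distinct [s2, s1, s3]" using dist by auto
  have o: "{s3, s1, s2} \<inter> {u, v, x1, x2, x3} = {}" "{s2, s1, s3} \<inter> {u, v, x1, x2, x3} = {}"
    using out by auto
  show ?thesis
    using adjacent_third_C2[OF G dist n out _ c a]
      adjacent_third_C2[OF G d(1,3), unfolded e, OF n(1,2,5,3,4) o(1) _ c a]
      adjacent_third_C2[OF G d(2,4), unfolded e, OF n(1,2,4,3,5) o(2) _ c a]
      independent_thirds_C1[OF G dist n out _ _ _ c a] by blast
qed

subsection \<open>Two coinciding third neighbours\<close>

text \<open>The prefix is a \<open>K\<^sub>3\<^sub>,\<^sub>3\<close> with parts \<open>{u, v, y}\<close> and
  \<open>{x1, x2, x3}\<close> that lacks the edge \<open>{x1, y}\<close>; exchanging the two parts is a symmetry.\<close>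

locale plug =
  fixes G :: "'a ugraph" and u v x1 x2 x3 y s t
  assumes G: "cubic_graph G" "triangle_free G"
    and dist: "distinct [u, v, x1, x2, x3, y]"
    and n: "nb G u = {x1, x2, x3}" "nb G v = {x1, x2, x3}"
      "nb G x1 = {u, v, s}" "nb G x2 = {u, v, y}" "nb G x3 = {u, v, y}" "nb G y = {x2, x3, t}"
    and out: "{s, t} \<inter> {u, v, x1, x2, x3, y} = {}"
    and c: "completable G {u, v, x1, x2, x3, y}" and a: "attached 1 G {u, v, x1, x2, x3, y}"
begin

lemma plug_swap: "plug G x2 x3 y u v x1 t s"
proof -
  have "{x2, x3, y, u, v, x1} = {u, v, x1, x2, x3, y}" by auto
  then show ?thesis using G dist n out c a by unfold_locales auto
qed

lemma in_s: "x1 \<in> nb G s" and in_t: "y \<in> nb G t"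
  by (rule nb_symD, simp add: n)+

lemma s_t_neq: "s \<noteq> u" "s \<noteq> v" "s \<noteq> x1" "s \<noteq> x2" "s \<noteq> x3" "s \<noteq> y"
  "t \<noteq> u" "t \<noteq> v" "t \<noteq> x1" "t \<noteq> x2" "t \<noteq> x3" "t \<noteq> y"
  using out by auto

lemma irr: "p \<notin> nb G p"
  using cubicD(6)[OF G(1)] .

lemma no_tri: "q \<in> nb G p \<Longrightarrow> r \<in> nb G p \<Longrightarrow> r \<notin> nb G q"
  using G(2) unfolding triangle_free_def by blast

lemma outside_P6:
  assumes "p \<in> nb G r" "p \<notin> {u, v, x1, x2, x3, y}"
  shows "r \<notin> {u, v, x2, x3}" "r = x1 \<longrightarrow> p = s" "r = y \<longrightarrow> p = t"
  using assms by (auto simp: n)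

context
  assumes st: "s \<noteq> t"
begin

abbreviation P8 where "P8 \<equiv> {u, v, x1, x2, x3, y, s, t}"

lemma completable_P8: "completable G P8"
proof -
  have "completable G (insert s {u, v, x1, x2, x3, y})"
    by (rule completable_absorb[OF c G(1), of x1]) (use s_t_neq n in auto)
  then have "completable G (insert t (insert s {u, v, x1, x2, x3, y}))"
    by (rule completable_absorb[OF _ G(1), of _ y]) (use s_t_neq n st in auto)
  then show ?thesis by (simp add: insert_commute)
qed

text \<open>\<open>s\<close> and \<open>t\<close> are the \<open>p\<close> and \<open>q\<close> of
  \<open>C5\<close>. Their remaining neighbours \<open>a'\<close> and \<open>b'\<close> differ,
  since a common one would complete a triangle.\<close>

lemma adjacent_C5:
  assumes adj: "t \<in> nb G s"
  shows "reducible 1 C5 G"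
proof -
  obtain a' where a': "nb G s = {x1, t, a'}" "a' \<noteq> x1" "a' \<noteq> t"
    using nb_third[OF G(1), of x1 t s] in_s adj s_t_neq by auto
  obtain b' where b': "nb G t = {y, s, b'}" "b' \<noteq> y" "b' \<noteq> s"
    using nb_third[OF G(1), of y s t] in_t nb_symD[OF adj] s_t_neq by auto
  have i: "s \<in> nb G a'" "t \<in> nb G b'" by (rule nb_symD, simp add: a' b')+
  have "a' \<notin> {u, v, x1, x2, x3, y, s, t}"
    using outside_P6[OF i(1)] irr[of s] i s_t_neq st a' by auto
  moreover have "b' \<notin> {u, v, x1, x2, x3, y, s, t}"
    using outside_P6[OF i(2)] irr[of t] i s_t_neq st b' by auto
  moreover have "a' \<noteq> b'" using no_tri[of t s a'] a' b' by auto
  moreover have "distinct [u, v, x1, x2, x3, y, s, t]" using dist s_t_neq st by auto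
  ultimately show ?thesis
    using reduce_C5[OF G _ n(1-5) n(6) a'(1) b'(1) _ _ completable_P8 attached_mono[OF a]] by blast
qed

context
  assumes nadj: "t \<notin> nb G s"
begin

lemma nadj': "s \<notin> nb G t"
  using nadj nb_symD by metis

lemma outside_s:
  assumes "p \<in> nb G s" "p \<noteq> x1" shows "p \<notin> P8"
  using outside_P6[OF nb_symD[OF assms(1)]] assms nadj irr[of s] s_t_neq st by auto

lemma outside_t:
  assumes "p \<in> nb G t" "p \<noteq> y" shows "p \<notin> P8"
  using outside_P6[OF nb_symD[OF assms(1)]] assms nadj' irr[of t] s_t_neq st by auto

lemma outside_P8:
  assumes "p \<in> nb G r" "p \<notin> P8" "r \<noteq> s" "r \<noteq> t"
  shows "r \<notin> P8"
  using outside_P6[OF assms(1)] assms by auto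

text \<open>This is \<open>C4\<close> with \<open>y1 = s\<close>, \<open>y2 = y\<close>,
  \<open>w2 = b\<close> and \<open>w3 = t\<close>; the required segment has just \<open>b\<close> in
  addition to \<open>P8\<close>.\<close>

lemma common_neighbour_C4:
  assumes b: "b \<in> nb G s" "b \<in> nb G t" and cb: "completable G (insert b P8)"
  shows "reducible 1 C4 G"
proof -
  have bo: "b \<notin> P8"
  proof (rule outside_s[OF b(1)])
    show "b \<noteq> x1" using nb_symD[OF b(2)] n s_t_neq st by auto
  qed
  obtain w where w: "nb G s = {x1, b, w}" "w \<noteq> x1" "w \<noteq> b"
    using nb_third[OF G(1), of x1 b s] in_s b bo by auto
  obtain t3 where t3: "nb G t = {y, b, t3}" "t3 \<noteq> y" "t3 \<noteq> b"
    using nb_third[OF G(1), of y b t] in_t b bo by auto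
  obtain b3 where b3: "nb G b = {s, t, b3}" "b3 \<noteq> s" "b3 \<noteq> t"
    using nb_third[OF G(1), of s t b] nb_symD[OF b(1)] nb_symD[OF b(2)] st by auto
  have "b \<in> nb G b3" by (rule nb_symD, simp add: b3)
  then have "b3 \<notin> P8" "b3 \<noteq> b" using outside_P8[of b b3] bo b3 irr[of b] by auto
  moreover have "w \<notin> P8" "t3 \<notin> P8" using outside_s[of w] outside_t[of t3] w t3 by auto
  ultimately have o: "{w, b3, t3} \<inter> {u, v, x1, x2, x3, s, y, b, t} = {}" using w t3 by blast
  have s: "nb G s = {x1, w, b}" using w by auto
  have e: "insert b P8 = {u, v, x1, x2, x3, s, y, b, t}" by auto
  have "distinct [u, v, x1, x2, x3, s, y, b, t]" using dist s_t_neq st bo by auto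
  then show ?thesis
    using reduce_C4[OF G _ n(1-5) s n(6) b3(1) t3(1) o cb[unfolded e] attached_mono[OF a]] by blast
qed

text \<open>This is \<open>C3\<close> with \<open>y1 = s\<close>, \<open>y2 = y\<close>,
  \<open>w1 = b\<close>, \<open>w2 = d\<close> and \<open>w3 = t\<close>. As \<open>b\<close> and
  \<open>d\<close> share the neighbour \<open>s\<close>, they are not adjacent, so \<open>b\<close>,
  \<open>d\<close> and \<open>t\<close> all have two outside neighbours and
  \<open>completable_cap\<close> yields \<open>z\<close>.\<close>

lemma no_common_neighbour_C3:
  assumes ns: "nb G s = {x1, b, d}" "distinct [x1, b, d]" and bt: "b \<notin> nb G t" "d \<notin> nb G t"
    and cb: "completable G (insert b (insert d P8))"
  shows "reducible 1 C3 G"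
proof -
  let ?P = "insert b (insert d P8)"
  have o: "b \<notin> P8" "d \<notin> P8" using outside_s[of b] outside_s[of d] ns by auto
  have i: "s \<in> nb G b" "s \<in> nb G d" by (rule nb_symD, simp add: ns)+
  have tb: "t \<notin> nb G b" "t \<notin> nb G d" by (use bt nb_symD in metis)+
  have bd: "d \<notin> nb G b" "b \<notin> nb G d" using no_tri[of b s d] no_tri[of d s b] ns by auto
  have ob: "p \<notin> ?P" if "p \<in> nb G b" "p \<noteq> s" for p
    using outside_P8[OF nb_symD[OF that(1)] o(1) that(2)] that tb bd irr[of b] by auto
  have od: "p \<notin> ?P" if "p \<in> nb G d" "p \<noteq> s" for p
    using outside_P8[OF nb_symD[OF that(1)] o(2) that(2)] that tb bd irr[of d] by auto
  have ot: "p \<notin> ?P" if "p \<in> nb G t" "p \<noteq> y" for p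
    using outside_t[OF that] that bt by auto
  have dF: "distinct [b, d, t]" using ns o by auto
  obtain z where z: "z \<notin> ?P" "nb G z = {b, d, t}" "completable G (insert z ?P)"
  proof (rule completable_cap[OF cb G(1) dF])
    show "\<not> nb G f \<subseteq> insert w ?P" if "f \<in> {b, d, t}" for f w
      using that two_outside[OF G(1) i(1), of ?P w] two_outside[OF G(1) i(2), of ?P w]
        two_outside[OF G(1) in_t, of ?P w] ob od ot by blast
    show "nb G p \<subseteq> ?P" if "p \<in> ?P" "p \<notin> {b, d, t}" for p
      using that by (auto simp: n ns)
  qed auto
  have zi: "z \<in> nb G b" "z \<in> nb G d" "z \<in> nb G t" by (rule nb_symD, simp add: z)+
  obtain s1 where s1: "nb G b = {s, z, s1}" "s1 \<noteq> s" "s1 \<noteq> z"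
    using nb_third[OF G(1), of s z b] i zi z(1) by auto
  obtain s2 where s2: "nb G d = {s, z, s2}" "s2 \<noteq> s" "s2 \<noteq> z"
    using nb_third[OF G(1), of s z d] i zi z(1) by auto
  obtain s3 where s3: "nb G t = {y, z, s3}" "s3 \<noteq> y" "s3 \<noteq> z"
    using nb_third[OF G(1), of y z t] in_t zi z(1) by auto
  have "{s1, s2, s3} \<inter> ?P = {}" using ob[of s1] od[of s2] ot[of s3] s1 s2 s3 by blast
  then have out': "{s1, s2, s3} \<inter> {u, v, x1, x2, x3, s, y, b, d, t, z} = {}"
    using s1 s2 s3 by blast
  have e: "insert z ?P = {u, v, x1, x2, x3, s, y, b, d, t, z}" by auto
  have "distinct [u, v, x1, x2, x3, s, y, b, d, t, z]" using dist s_t_neq st o z(1) ns by auto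
  then show ?thesis
    using reduce_C3[OF G _ n(1-5) ns(1) n(6) s1(1) s2(1) s3(1) z(2) out' z(3)[unfolded e]
        attached_mono[OF a]] by blast
qed

text \<open>With \<open>d\<close> placed, \<open>s\<close> has a single outside neighbour
  \<open>b\<close>, which is absorbed; whether \<open>b\<close> is also adjacent to \<open>t\<close>
  decides between \<open>C4\<close> and \<open>C3\<close>.\<close>

lemma one_sided:
  assumes d: "d \<in> nb G s" "d \<notin> nb G t" "d \<noteq> x1" and cd: "completable G (insert d P8)"
  shows "reducible 1 C3 G \<or> reducible 1 C4 G"
proof -
  obtain b where b: "nb G s = {x1, d, b}" "b \<noteq> x1" "b \<noteq> d"
    using nb_third[OF G(1), of x1 d s] in_s d by auto
  have bo: "b \<notin> P8" "d \<notin> P8" using outside_s[of b] outside_s[of d] b d by auto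
  have cb: "completable G (insert b (insert d P8))"
    by (rule completable_absorb[OF cd G(1), of s]) (use b bo in auto)
  show ?thesis
  proof (cases "b \<in> nb G t")
    case True
    \<comment> \<open>Since \<open>s\<close> is closed by now, the boundary is small enough for
      \<open>d\<close> to be released, which leaves the common neighbour \<open>b\<close> alone on
      top of \<open>P8\<close>.\<close>
    have "bd G (insert b (insert d P8)) \<subseteq> {d, b, t}" by (auto simp: bd_def n b)
    moreover have "d \<notin> insert b P8" using bo b(3) by auto
    ultimately have "completable G (insert b P8)"
      using cb completable_down[of G d "insert b P8" d b t] unfolding insert_commute[of b d P8]
      by blast
    then show ?thesis using common_neighbour_C4[of b] b True by auto
  next
    case False
    have "nb G s = {x1, b, d}" "distinct [x1, b, d]" using b d by auto
    then show ?thesis using no_common_neighbour_C3 False d cb by blast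
  qed
qed

end

lemma nonadjacent:
  assumes nadj: "t \<notin> nb G s"
  shows "reducible 1 C3 G \<or> reducible 1 C4 G"
proof -
  \<comment> \<open>The swapped copy exchanges \<open>s\<close> and \<open>t\<close>; it handles a
    next vertex that is adjacent to \<open>t\<close> only.\<close>
  interpret sw: plug G x2 x3 y u v x1 t s by (rule plug_swap)
  have nadj': "s \<notin> nb G t" using nadj nb_symD by metis
  have e: "sw.P8 = P8" by auto
  obtain b0 c0 where bc: "nb G s = {x1, b0, c0}" "distinct [x1, b0, c0]"
    using nb_second_third[OF G(1) in_s] .
  have "b0 \<notin> P8" using outside_s[OF nadj, of b0] bc by auto
  moreover have "b0 \<in> verts G" using cubicD(5)[OF G(1), of s] bc by auto
  ultimately have "P8 \<noteq> verts G" by blast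
  then obtain d where d: "d \<in> verts G" "d \<notin> P8" "completable G (insert d P8)"
    using completable_next[OF completable_P8] by metis
  consider "d \<in> nb G s" "d \<in> nb G t" | "d \<in> nb G s" "d \<notin> nb G t" | "d \<notin> nb G s" "d \<in> nb G t"
    | "d \<notin> nb G s" "d \<notin> nb G t" by blast
  then show ?thesis
  proof cases
    case 1
    then show ?thesis using common_neighbour_C4[OF nadj] d by blast
  next
    case 2
    then show ?thesis using one_sided[OF nadj] d by blast
  next
    case 3
    then show ?thesis using sw.one_sided[OF st[symmetric] nadj', of d] d unfolding e by blast
  next
    case 4
    \<comment> \<open>Here \<open>d\<close> has no neighbour in the segment, so \<open>s\<close>,
      \<open>t\<close> and \<open>d\<close> all stay open and the next vertex is adjacent to all
      three. After releasing \<open>d\<close>, that vertex is the common neighbour needed for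
      \<open>C4\<close>.\<close>
    let ?P = "insert d P8"
    have o: "p \<notin> ?P" if "p \<in> nb G d" for p
    proof -
      have "p \<noteq> s" "p \<noteq> t" using 4 that nb_symD by metis+
      then show ?thesis using outside_P8[OF nadj nb_symD[OF that] d(2)] irr[of d] that by auto
    qed
    have os: "p \<notin> ?P" if "p \<in> nb G s" "p \<noteq> x1" for p
      using outside_s[OF nadj that] that 4 by auto
    have ot: "p \<notin> ?P" if "p \<in> nb G t" "p \<noteq> y" for p
      using outside_t[OF nadj that] that 4 by auto
    have "nb G d \<noteq> {}" using cubicD(3)[OF G(1) d(1)] by auto
    \<comment> \<open>All three neighbours of \<open>d\<close> lie outside, so any one of them may
      act as the exempt vertex in \<open>two_outside\<close>.\<close>
    then obtain d' where d': "d' \<in> nb G d" by blast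
    have dF: "distinct [s, t, d]" using st d by auto
    obtain z where z: "z \<notin> ?P" "nb G z = {s, t, d}" "completable G (insert z ?P)"
    proof (rule completable_cap[OF d(3) G(1) dF])
      show "\<not> nb G f \<subseteq> insert w ?P" if "f \<in> {s, t, d}" for f w
        using that two_outside[OF G(1) in_s, of ?P w] two_outside[OF G(1) in_t, of ?P w]
          two_outside[OF G(1) d', of ?P w] o os ot by blast
      show "nb G p \<subseteq> ?P" if "p \<in> ?P" "p \<notin> {s, t, d}" for p
        using that by (auto simp: n)
    qed auto
    have "bd G (insert z ?P) \<subseteq> {s, t, d}" by (auto simp: bd_def n z(2))
    moreover have "d \<notin> insert z P8" using z d by auto
    ultimately have "completable G (insert z P8)"
      using z(3) completable_down[of G d "insert z P8" s t d] unfolding insert_commute[of z d P8]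
      by blast
    moreover have "z \<in> nb G s" "z \<in> nb G t" by (rule nb_symD, simp add: z)+
    ultimately show ?thesis using common_neighbour_C4[OF nadj] by blast
  qed
qed

end

text \<open>The edge from \<open>s\<close> to \<open>q\<close> is a bridge, so \<open>q\<close> is
  the only boundary vertex of the eight-vertex segment. \<open>C6\<close> is reversed with
  \<open>s\<close> and \<open>q\<close> as its \<open>p\<close> and \<open>q\<close>, and with the
  other neighbours \<open>a'\<close> and \<open>b'\<close> of \<open>q\<close> as its
  \<open>s\<close> and \<open>t\<close>; the work lies in bringing these two to the front.\<close>

lemma equal_C6:
  assumes st: "s = t"
  shows "reducible 1 C6 G"
proof -
  let ?P6 = "{u, v, x1, x2, x3, y}"
  have nx1: "nb G x1 = {u, v, s}" and ny: "nb G y = {x2, x3, s}" using n st by auto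
  obtain q where q: "nb G s = {x1, y, q}" "q \<noteq> x1" "q \<noteq> y"
    using nb_third[OF G(1), of x1 y s] in_s in_t st dist by auto
  have "s \<in> nb G q" by (rule nb_symD, simp add: q)
  then have qo: "q \<notin> insert s ?P6" using outside_P6[of s q] s_t_neq irr[of s] q by auto
  let ?P8 = "insert q (insert s ?P6)"
  have "completable G (insert s ?P6)"
    by (rule completable_absorb[OF c G(1), of x1]) (use s_t_neq n in auto)
  then have c8: "completable G ?P8"
    by (rule completable_absorb[OF _ G(1), of _ s]) (use q qo in auto)
  obtain a' b' where ab: "nb G q = {s, a', b'}" "distinct [s, a', b']"
    using nb_second_third[OF G(1) \<open>s \<in> nb G q\<close>] .
  have out8: "p \<notin> ?P8" if "r \<in> nb G p" "r \<notin> ?P8" "p \<noteq> q" for p r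
    using that by (auto simp: n st[symmetric] q)
  have outq: "p \<notin> ?P8" if "p \<in> nb G q" "p \<noteq> s" for p
    using nb_symD[OF that(1)] that qo irr[of q] s_t_neq st by (auto simp: n)
  have abo: "a' \<notin> ?P8" "b' \<notin> ?P8" using outq ab by auto
  have av: "a' \<in> verts G" using cubicD(5)[OF G(1), of q] ab by auto
  \<comment> \<open>Otherwise the next two vertices avoid the neighbours of \<open>q\<close> and
    fill the boundary together with \<open>q\<close>. The vertex after them is adjacent to all
    three, hence equals \<open>a'\<close> or \<open>b'\<close>, and releasing the two shows that it
    could have come first.\<close>
  have "completable G (insert a' ?P8) \<or> completable G (insert b' ?P8)"
  proof (rule ccontr)
    assume no: "\<not> ?thesis"
    from av abo have "?P8 \<noteq> verts G" by blast
    then obtain w1 where w1: "w1 \<in> verts G" "w1 \<notin> ?P8" "completable G (insert w1 ?P8)"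
      using completable_next[OF c8] by metis
    have w1q: "w1 \<noteq> a'" "w1 \<noteq> b'" using w1 no by auto
    then have "a' \<notin> insert w1 ?P8" using abo by auto
    with av have "insert w1 ?P8 \<noteq> verts G" by blast
    then obtain w2 where w2: "w2 \<in> verts G" "w2 \<notin> insert w1 ?P8"
      "card (bd G (insert w2 (insert w1 ?P8))) \<le> 3" "completable G (insert w2 (insert w1 ?P8))"
      using completable_next[OF w1(3)] by metis
    \<comment> \<open>\<open>w1\<close> and \<open>w2\<close> may come in either order, since
      completability of a set asks nothing of its own boundary.\<close>
    have "completable G (insert w2 ?P8)" if "w2 \<in> {a', b'}"
    proof (rule completable.step)
      show "w1 \<in> verts G - insert w2 ?P8" using w1 w2 by auto
    qed (use w2 in \<open>simp_all only: insert_commute[of w1 w2]\<close>)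
    then have w2q: "w2 \<noteq> a'" "w2 \<noteq> b'" using no by auto
    let ?P = "insert w2 (insert w1 ?P8)"
    have w12: "w1 \<notin> nb G q" "w2 \<notin> nb G q" using ab w1q w2q w1(2) w2(2) by auto
    have oq: "p \<notin> ?P" if "p \<in> nb G q" "p \<noteq> s" for p
      using outq[OF that] that w12 by auto
    have w1n: "nb G w1 \<inter> ?P8 = {}" "nb G w2 \<inter> ?P8 = {}"
    proof -
      have "p \<notin> ?P8" if "p \<in> nb G w1" for p
        using out8[OF nb_symD[OF that] w1(2)] nb_symD[OF that] w12 by metis
      then show "nb G w1 \<inter> ?P8 = {}" by blast
      have "p \<notin> ?P8" if "p \<in> nb G w2" for p
        using out8[OF nb_symD[OF that]] nb_symD[OF that] w12 w2(2) by (metis insertCI)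
      then show "nb G w2 \<inter> ?P8 = {}" by blast
    qed
    have op1: "\<not> nb G w1 \<subseteq> insert w ?P" for w
    proof
      assume "nb G w1 \<subseteq> insert w ?P"
      then have "nb G w1 \<subseteq> {w, w2}" using w1n irr[of w1] by blast
      then have "card (nb G w1) \<le> card {w, w2}" by (intro card_mono) auto
      also have "\<dots> \<le> 2" by (simp add: card_insert_if)
      finally show False using cubicD(3)[OF G(1) w1(1)] by simp
    qed
    have op2: "\<not> nb G w2 \<subseteq> insert w ?P" for w
    proof
      assume "nb G w2 \<subseteq> insert w ?P"
      then have "nb G w2 \<subseteq> {w, w1}" using w1n irr[of w2] by blast
      then have "card (nb G w2) \<le> card {w, w1}" by (intro card_mono) auto
      also have "\<dots> \<le> 2" by (simp add: card_insert_if)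
      finally show False using cubicD(3)[OF G(1) w2(1)] by simp
    qed
    have dF: "distinct [q, w1, w2]" using w1 w2 by auto
    obtain z where z: "z \<notin> ?P" "nb G z = {q, w1, w2}" "completable G (insert z ?P)"
    proof (rule completable_cap[OF w2(4) G(1) dF])
      show "\<not> nb G f \<subseteq> insert w ?P" if "f \<in> {q, w1, w2}" for f w
        using that two_outside[OF G(1) \<open>s \<in> nb G q\<close>, of ?P w] oq op1 op2 by blast
      show "nb G p \<subseteq> ?P" if "p \<in> ?P" "p \<notin> {q, w1, w2}" for p
        using that by (auto simp: n st[symmetric] q)
    qed auto
    have e: "insert z ?P = insert w2 (insert w1 (insert z ?P8))" by auto
    have "bd G (insert z ?P) \<subseteq> {q, w1, w2}"
      by (auto simp: bd_def n st[symmetric] q z(2))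
    moreover have "w2 \<notin> insert w1 (insert z ?P8)" using z w2 by auto
    ultimately have "completable G (insert w1 (insert z ?P8))"
      using z(3) completable_down[of G w2 "insert w1 (insert z ?P8)" q w1 w2] unfolding e by blast
    moreover have "bd G (insert w1 (insert z ?P8)) \<subseteq> {q, w1, z}"
      by (auto simp: bd_def n st[symmetric] q)
    moreover have "w1 \<notin> insert z ?P8" using z w1 by auto
    ultimately have "completable G (insert z ?P8)"
      using completable_down[of G w1 "insert z ?P8" q w1 z] by blast
    moreover have "q \<in> nb G z" using z by simp
    then have "z \<in> nb G q" by (rule nb_symD)
    then have "z = a' \<or> z = b'" using ab z(1) by auto
    ultimately show False using no by blast
  qed
  then have c10: "completable G (insert b' (insert a' ?P8))"
  proof
    assume "completable G (insert a' ?P8)"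
    then show ?thesis
      by (rule completable_absorb[OF _ G(1), of _ q]) (use ab abo in auto)
  next
    assume "completable G (insert b' ?P8)"
    then have "completable G (insert a' (insert b' ?P8))"
      by (rule completable_absorb[OF _ G(1), of _ q]) (use ab abo in auto)
    then show ?thesis by (simp only: insert_commute[of a' b'])
  qed
  have qa: "q \<in> nb G a'" "q \<in> nb G b'" by (rule nb_symD, simp add: ab)+
  obtain a1 a2 where a12: "nb G a' = {q, a1, a2}" "distinct [q, a1, a2]"
    using nb_second_third[OF G(1) qa(1)] .
  obtain b1 b2 where b12: "nb G b' = {q, b1, b2}" "distinct [q, b1, b2]"
    using nb_second_third[OF G(1) qa(2)] .
  have nab: "b' \<notin> nb G a'" "a' \<notin> nb G b'" using no_tri[of a' q b'] no_tri[of b' q a'] ab by auto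
  have "p \<notin> insert b' (insert a' ?P8)" if "p \<in> nb G a'" "p \<noteq> q" for p
    using out8[OF nb_symD[OF that(1)] abo(1) that(2)] that nab irr[of a'] by auto
  moreover have "p \<notin> insert b' (insert a' ?P8)" if "p \<in> nb G b'" "p \<noteq> q" for p
    using out8[OF nb_symD[OF that(1)] abo(2) that(2)] that nab irr[of b'] by auto
  ultimately have "{a1, a2, b1, b2} \<inter> insert b' (insert a' ?P8) = {}"
    using a12 b12 by auto
  moreover have e: "insert b' (insert a' ?P8) = {u, v, x1, x2, x3, y, s, q, a', b'}" by auto
  ultimately have o: "{a1, a2, b1, b2} \<inter> {u, v, x1, x2, x3, y, s, q, a', b'} = {}" by simp
  have "distinct [u, v, x1, x2, x3, y, s, q, a', b']" "a1 \<noteq> a2 \<and> b1 \<noteq> b2"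
    using dist s_t_neq qo abo ab a12 b12 by auto
  then show ?thesis
    using reduce_C6[OF G _ n(1,2) nx1 n(4,5) ny q(1) ab(1) a12(1) b12(1) o _ c10[unfolded e]
        attached_mono[OF a]] by blast
qed

lemma reducible_plug:
  "reducible 1 C3 G \<or> reducible 1 C4 G \<or> reducible 1 C5 G \<or> reducible 1 C6 G"
  using equal_C6 adjacent_C5 nonadjacent by blast

end

text \<open>Every edge leaving the six vertices starts at \<open>x1\<close> or \<open>y\<close>, so
  everything beyond them is a set with at most two outer neighbours.\<close>

lemma (in plug) not_attached_3: "\<not> attached 3 G {u, v, x1, x2, x3}"
proof
  assume a3: "attached 3 G {u, v, x1, x2, x3}"
  let ?Y = "verts G - {u, v, x1, x2, x3, y}"
  have "s \<in> ?Y" using cubicD(5)[OF G(1), of x1] s_t_neq by (auto simp: n)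
  then have "3 \<le> card (\<Union>(nb G ` ?Y) - ?Y)"
    using a3[unfolded attached_def, rule_format, of ?Y] by blast
  also have "\<dots> \<le> card {x1, y}"
  proof (rule card_mono)
    show "\<Union>(nb G ` ?Y) - ?Y \<subseteq> {x1, y}"
    proof
      fix w assume "w \<in> \<Union>(nb G ` ?Y) - ?Y"
      then obtain r where r: "w \<in> nb G r" "r \<in> ?Y" "w \<notin> ?Y" by blast
      then have "w \<in> verts G" using cubicD(5)[OF G(1), of r] by blast
      then have "w \<in> {u, v, x1, x2, x3, y}" using r by blast
      then show "w \<in> {x1, y}" using nb_symD[OF r(1)] r(2) by (auto simp: n)
    qed
  qed simp
  also have "\<dots> \<le> 2" by (simp add: card_insert_if)
  finally show False by simp
qed

lemma plug_if_two_thirds_equal: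
  assumes G: "cubic_graph G" "triangle_free G"
    and dist: "distinct [u, v, x1, x2, x3]"
    and n: "nb G u = {x1, x2, x3}" "nb G v = {x1, x2, x3}"
      "nb G x1 = {u, v, s}" "nb G x2 = {u, v, y}" "nb G x3 = {u, v, y}"
    and out: "{s, y} \<inter> {u, v, x1, x2, x3} = {}" and sy: "s \<noteq> y"
    and c: "completable G {u, v, x1, x2, x3}" and a: "attached 1 G {u, v, x1, x2, x3}"
  shows "\<exists>t. plug G u v x1 x2 x3 y s t"
proof -
  have y: "x2 \<in> nb G y" "x3 \<in> nb G y" by (rule nb_symD, simp add: n)+
  obtain t where t: "nb G y = {x2, x3, t}" "t \<noteq> x2" "t \<noteq> x3"
    using nb_third[OF G(1), of x2 x3 y] y dist by auto
  have "y \<in> nb G t" by (rule nb_symD, simp add: t)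
  moreover have "y \<notin> nb G p" if "p \<in> {u, v, x1}" for p
    using that out sy by (auto simp: n)
  moreover have "t \<noteq> y" using cubicD(6)[OF G(1), of y] by (auto simp: t(1))
  ultimately have "t \<notin> {u, v, x1, x2, x3, y}" using t(2,3) by blast
  moreover have "completable G (insert y {u, v, x1, x2, x3})"
    by (rule completable_absorb[OF c G(1), of x2]) (use out n in auto)
  moreover have e: "insert y {u, v, x1, x2, x3} = {u, v, x1, x2, x3, y}" by auto
  ultimately have "plug G u v x1 x2 x3 y s t"
    using G dist n out sy t attached_mono[OF a, of "{u, v, x1, x2, x3, y}"]
    by unfold_locales auto
  then show ?thesis ..
qed

text \<open>With \<open>y\<close> the six vertices are closed, so the rest of the graph would be a
  set without outer neighbours; by \<open>attached 1\<close> it is empty.\<close>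

lemma three_equal_thirds_K33:
  assumes G: "cubic_graph G"
    and dist: "distinct [u, v, x1, x2, x3]"
    and n: "nb G u = {x1, x2, x3}" "nb G v = {x1, x2, x3}"
      "nb G x1 = {u, v, y}" "nb G x2 = {u, v, y}" "nb G x3 = {u, v, y}"
    and out: "y \<notin> {u, v, x1, x2, x3}"
    and c: "{u, v, x1, x2, x3} \<subseteq> verts G" and a: "attached 1 G {u, v, x1, x2, x3}"
  shows "complete_bipartite 3 3 G"
proof -
  have y: "x1 \<in> nb G y" "x2 \<in> nb G y" "x3 \<in> nb G y" by (rule nb_symD, simp add: n)+
  obtain t where "nb G y = {x1, x2, t}" using nb_third[OF G, of x1 x2 y] y dist by auto
  with y dist have ny: "nb G y = {x1, x2, x3}" by auto
  let ?A = "{u, v, y}" and ?B = "{x1, x2, x3}"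
  let ?Y = "verts G - (?A \<union> ?B)"
  have yV: "y \<in> verts G" using cubicD(5)[OF G, of x1] by (simp add: n)
  have "w \<in> ?Y" if "w \<in> nb G r" "r \<in> ?Y" for w r
    using nb_symD[OF that(1)] that cubicD(5)[OF G, of r] by (auto simp: n ny)
  then have "\<Union>(nb G ` ?Y) - ?Y = {}" by blast
  then have "card (\<Union>(nb G ` ?Y) - ?Y) = 0" by (simp only: card.empty)
  then have "?Y = {}" using a[unfolded attached_def, rule_format, of ?Y] by fastforce
  then have V: "verts G = ?A \<union> ?B" using c yV by blast
  have "edges G = biclique ?A ?B"
  proof
    show "biclique ?A ?B \<subseteq> edges G" by (auto simp: biclique_def edge_iff_nb n ny)
    show "edges G \<subseteq> biclique ?A ?B"
    proof
      fix e assume e: "e \<in> edges G"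
      then obtain p q where pq: "e = {p, q}"
        using cubicD(1)[OF G] unfolding simple_graph_def by (meson card_2_iff)
      then have q: "q \<in> nb G p" "p \<in> nb G q" using e nb_symD[of q G p] by (auto simp: nb_def)
      then have "p \<in> ?A \<union> ?B" using cubicD(5)[OF G, of q] V by auto
      then have "p \<in> ?A \<and> q \<in> ?B \<or> p \<in> ?B \<and> q \<in> ?A" using q(1) by (auto simp: n ny)
      then show "e \<in> biclique ?A ?B" unfolding biclique_def pq by (auto simp: insert_commute)
    qed
  qed
  moreover have "card ?A = 3" "card ?B = 3" "?A \<inter> ?B = {}" using dist out by auto
  ultimately show ?thesis unfolding complete_bipartite_def
    using V by (intro exI[of _ ?A] exI[of _ ?B]) simp
qed

section \<open>Case distinction and induction on the number of vertices\<close>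

lemma K23_start_reducible:
  assumes "K23_start k G" "1 \<le> k"
  shows "complete_bipartite 3 3 G \<or> reducible k C1 G \<or> reducible k C2 G \<or>
    k < 3 \<and> (\<exists>C\<in>{C3, C4, C5, C6}. reducible 1 C G)"
proof -
  obtain u v where uv: "cubic_graph G" "triangle_free G" "u \<in> verts G" "u \<noteq> v" "nb G u = nb G v"
    "completable G ({u, v} \<union> nb G u)" "attached k G ({u, v} \<union> nb G u)"
    using assms(1) unfolding K23_start_def by blast
  note G = uv(1,2)
  obtain x1 x2 x3 where X: "nb G u = {x1, x2, x3}" "x1 \<noteq> x2" "x2 \<noteq> x3" "x1 \<noteq> x3"
    using cubicD(3)[OF G(1) uv(3)] card_3_iff by metis
  have Xv: "nb G v = {x1, x2, x3}" using X uv by simp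
  have i: "u \<in> nb G x1" "v \<in> nb G x1" "u \<in> nb G x2" "v \<in> nb G x2" "u \<in> nb G x3" "v \<in> nb G x3"
    by (rule nb_symD, simp add: X Xv)+
  obtain s1 where s1: "nb G x1 = {u, v, s1}" "s1 \<noteq> u" "s1 \<noteq> v"
    using nb_third[OF G(1), of u v x1] i uv(4) by auto
  obtain s2 where s2: "nb G x2 = {u, v, s2}" "s2 \<noteq> u" "s2 \<noteq> v"
    using nb_third[OF G(1), of u v x2] i uv(4) by auto
  obtain s3 where s3: "nb G x3 = {u, v, s3}" "s3 \<noteq> u" "s3 \<noteq> v"
    using nb_third[OF G(1), of u v x3] i uv(4) by auto
  have ind: "p \<notin> nb G q" if "p \<in> {x1, x2, x3}" "q \<in> {x1, x2, x3}" for p q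
    using G(2) that X(1) unfolding triangle_free_def by blast
  have "s1 \<notin> {x1, x2, x3}" "s2 \<notin> {x1, x2, x3}" "s3 \<notin> {x1, x2, x3}"
    using ind[of s1 x1] ind[of s2 x2] ind[of s3 x3] s1(1) s2(1) s3(1) by blast+
  then have out: "{s1, s2, s3} \<inter> {u, v, x1, x2, x3} = {}"
    using s1(2,3) s2(2,3) s3(2,3) by blast
  have irr: "u \<notin> nb G u" "v \<notin> nb G v" using cubicD(6)[OF G(1)] by blast+
  have dist: "distinct [u, v, x1, x2, x3]" using X Xv uv(4) irr by auto
  have e: "{u, v} \<union> nb G u = {u, v, x1, x2, x3}" using X by auto
  note c = uv(6)[unfolded e] and att = uv(7)[unfolded e]
  have a1: "attached 1 G {u, v, x1, x2, x3}" using attached_le[OF att assms(2)] .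
  \<comment> \<open>The cut pair of a plug rules out \<open>k = 3\<close>. The set equation lets one
    argument serve all three labellings of the \<open>xi\<close>.\<close>
  have pl: ?thesis if "plug G p q y1 y2 y3 y s t" "{p, q, y1, y2, y3} = {u, v, x1, x2, x3}"
    for p q y1 y2 y3 y s t
  proof -
    interpret plug G p q y1 y2 y3 y s t by (rule that(1))
    have "k < 3" using not_attached_3 attached_le[OF att, of 3] unfolding that(2) by linarith
    then show ?thesis using reducible_plug by blast
  qed
  consider "distinct [s1, s2, s3]" | "s1 = s2" "s2 = s3" | "s1 \<noteq> s2" "s2 = s3"
    | "s2 \<noteq> s1" "s1 = s3" | "s3 \<noteq> s1" "s1 = s2" by auto
  then show ?thesis
  proof cases
    case 1
    then show ?thesis using distinct_thirds[OF G dist _ X(1) Xv s1(1) s2(1) s3(1) out c att] by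
        blast
  next
    case 2
    then have "nb G x2 = {u, v, s1}" "nb G x3 = {u, v, s1}" "s1 \<notin> {u, v, x1, x2, x3}"
      using s2(1) s3(1) out by auto
    then show ?thesis
      using three_equal_thirds_K33[OF G(1) dist X(1) Xv s1(1) _ _ _ completable_subset[OF c] a1]
      by simp
  next
    case 3
    then have "\<exists>t. plug G u v x1 x2 x3 s3 s1 t"
      using plug_if_two_thirds_equal[OF G dist X(1) Xv s1(1), of s3] s2(1) s3(1) out c a1 by auto
    then show ?thesis using pl by blast
  next
    case 4
    have e2: "{x2, x1, x3} = {x1, x2, x3}" "{u, v, x2, x1, x3} = {u, v, x1, x2, x3}" by auto
    have "\<exists>t. plug G u v x2 x1 x3 s3 s2 t"
      by (rule plug_if_two_thirds_equal[OF G])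
        (use dist out c a1 4 X Xv s1(1) s2(1) s3(1) in \<open>auto simp: e2\<close>)
    then show ?thesis using pl e2(2) by blast
  next
    case 5
    have e2: "{x3, x1, x2} = {x1, x2, x3}" "{u, v, x3, x1, x2} = {u, v, x1, x2, x3}" by auto
    have "\<exists>t. plug G u v x3 x1 x2 s2 s3 t"
      by (rule plug_if_two_thirds_equal[OF G])
        (use dist out c a1 5 X Xv s1(1) s2(1) s3(1) in \<open>auto simp: e2\<close>)
    then show ?thesis using pl e2(2) by blast
  qed
qed

text \<open>Reversing \<open>C3\<close> to \<open>C6\<close> preserves the invariant with
  \<open>k = 1\<close> only, and with \<open>k = 3\<close> these cases do not arise; hence the two
  pairings of \<open>k\<close> with \<open>steps\<close>.\<close>

lemma K23_start_obtainable:
  assumes "K23_start k G" "k = 3 \<and> {C1, C2} \<subseteq> steps \<or> k = 1 \<and> {C1, C2, C3, C4, C5, C6} \<subseteq> steps"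
  shows "obtainable_from_K33 steps G"
  using assms(1)
proof (induction "card (verts G)" arbitrary: G rule: less_induct)
  case less
  show ?case
  proof (cases "complete_bipartite 3 3 G")
    case True
    then show ?thesis by (rule K33)
  next
    case False
    then have "\<exists>C\<in>steps. reducible k C G"
      using K23_start_reducible[OF less.prems] assms(2) by auto
    then obtain C G' where C: "C \<in> steps" "C G' G" "K23_start k G'" "card (verts G') < card (verts
        G)"
      unfolding reducible_def by blast
    have "obtainable_from_K33 steps G'" by (rule less.hyps[OF C(4,3)])
    then show ?thesis
      using C(1) _ C(2) by (rule obtainable_from_K33.step) (use C(3) less.prems in \<open>simp_all add:
          K23_start_def\<close>)
  qed
qed

section \<open>From girth, connectedness and path-width to the starting configuration\<close>

lemma triangle_free_if_girth:
  assumes "simple_graph G" "girth G = 4"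
  shows "triangle_free G"
  unfolding triangle_free_def
proof (intro allI impI, rule ccontr)
  fix x y assume xy: "y \<in> nb G x" "nb G x \<inter> nb G y \<noteq> {}"
  then obtain z where z: "z \<in> nb G x" "z \<in> nb G y" by auto
  have "is_cycle G [x, y, z]"
    unfolding is_cycle_def
  proof (intro conjI allI impI)
    show "distinct [x, y, z]" using nb_verts(3)[OF assms(1)] xy z by auto
    fix i assume "i < length [x, y, z]"
    then consider "i = 0" | "i = 1" | "i = 2" by fastforce
    then show "{[x, y, z] ! i, [x, y, z] ! (Suc i mod length [x, y, z])} \<in> edges G"
      using xy z by cases (simp_all add: nb_def insert_commute)
  qed simp
  then have "girth G \<le> enat 3" unfolding girth_def by (intro INF_lower2[of "[x, y, z]"]) auto
  then show False using assms(2) by (simp add: numeral_eq_enat)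
qed

text \<open>If the set \<open>S\<close> of outer neighbours of \<open>Y\<close> were too small,
  \<open>Q\<close>, having more vertices, would contain one outside \<open>S\<close>. No walk
  avoiding \<open>S\<close> leaves \<open>Y\<close>, so deleting \<open>S\<close> would separate
  that vertex from \<open>Y\<close>.\<close>

lemma attached_if_cut_connected:
  assumes G: "cubic_graph G" and k: "k < card Q" and Q: "Q \<subseteq> verts G"
    and conn: "\<And>S. S \<subseteq> verts G \<Longrightarrow> card S < k \<Longrightarrow> connected_graph (delete_verts G S)"
  shows "attached k G Q"
  unfolding attached_def
proof (intro allI impI, rule ccontr)
  fix Y assume Y: "Y \<noteq> {} \<and> Y \<subseteq> verts G - Q"
  let ?S = "\<Union>(nb G ` Y) - Y"
  assume "\<not> k \<le> card ?S"
  then have S: "card ?S < k" by simp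
  have SV: "?S \<subseteq> verts G" using cubicD(5)[OF G] by blast
  then have fS: "finite ?S" using cubicD(2)[OF G] finite_subset by blast
  from Y obtain y where y: "y \<in> Y" by auto
  have "\<not> Q \<subseteq> ?S" using card_mono[OF fS, of Q] S k by linarith
  then obtain q where q: "q \<in> Q" "q \<notin> ?S" by auto
  let ?H = "delete_verts G ?S"
  have "y \<in> verts ?H" "q \<in> verts ?H" using y q Y Q by (auto simp: delete_verts_def)
  then have "(y, q) \<in> {(a, b). {a, b} \<in> edges ?H}\<^sup>*"
    using conn[OF SV S] unfolding connected_graph_def by blast
  then have "q \<in> Y"
  proof (induction rule: rtrancl_induct)
    case (step a b)
    then have "b \<in> nb G a" "b \<notin> ?S" by (auto simp: delete_verts_def nb_def)
    then show ?case using step.IH by blast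
  qed (fact y)
  then show False using q Y by blast
qed

text \<open>Triangle-freeness makes the three leaves of the claw swallowed by the first four vertices
  independent, so the fifth vertex has to absorb all of them at once.\<close>

lemma completable_empty_K23:
  assumes G: "cubic_graph G" "triangle_free G" and c: "completable G {}"
  obtains u v where "u \<in> verts G" "u \<noteq> v" "nb G u = nb G v" "completable G ({u, v} \<union> nb G u)"
proof -
  have grow: "\<exists>w P'. P' = insert w P \<and> w \<notin> P \<and> card (bd G P') \<le> 3 \<and> completable G P' \<and> card P' = Suc
      (card P)"
    if P: "completable G P" "P \<noteq> verts G" for P
  proof -
    obtain w where "w \<in> verts G" "w \<notin> P" "card (bd G (insert w P)) \<le> 3" "completable G (insert w P)"
      using completable_next[OF P] .
    moreover have "finite P" using completable_subset[OF P(1)] cubicD(2)[OF G(1)] finite_subset by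
        blast
    ultimately show ?thesis by auto
  qed
  obtain x where x: "x \<in> verts G" using cubicD(1)[OF G(1)] by (auto simp: simple_graph_def)
  have "card (insert x (nb G x)) = 4" using cubicD(3)[OF G(1) x] cubicD(4,6)[OF G(1)] by simp
  moreover have "insert x (nb G x) \<subseteq> verts G" using x cubicD(5)[OF G(1)] by blast
  ultimately have V4: "4 \<le> card (verts G)" using card_mono[OF cubicD(2)[OF G(1)]] by metis
  obtain P1 where P1: "completable G P1" "card P1 = 1" using grow[OF c] x by fastforce
  have "P1 \<noteq> verts G" using P1 V4 by auto
  then obtain P2 where P2: "completable G P2" "card P2 = 2" using grow[OF P1(1)] P1(2) by fastforce
  have "P2 \<noteq> verts G" using P2 V4 by auto
  then obtain P3 where P3: "completable G P3" "card P3 = 3" using grow[OF P2(1)] P2(2) by fastforce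
  have "P3 \<noteq> verts G" using P3 V4 by auto
  then obtain P4 where P4: "completable G P4" "card P4 = 4" "card (bd G P4) \<le> 3"
    using grow[OF P3(1)] P3(2) by fastforce
  have f4: "finite P4" using P4 by (metis card.infinite zero_neq_numeral)
  \<comment> \<open>At most three of the four vertices are open; a closed one makes up all of
    \<open>P4\<close> together with its neighbours.\<close>
  have "bd G P4 \<noteq> P4" using P4 by auto
  then obtain u where u: "u \<in> P4" "nb G u \<subseteq> P4" by (auto simp: bd_def)
  have uV: "u \<in> verts G" using completable_subset[OF P4(1)] u by blast
  have "card (insert u (nb G u)) = 4" using cubicD(3)[OF G(1) uV] cubicD(4,6)[OF G(1)] by simp
  then have e4: "insert u (nb G u) = P4" using u f4 P4(2) by (intro card_subset_eq) auto
  have ind: "nb G x \<inter> nb G u = {}" if "x \<in> nb G u" for x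
    using G(2) that unfolding triangle_free_def by blast
  have leaf: "\<not> nb G x \<subseteq> insert w P4" if "x \<in> nb G u" "x \<notin> nb G w" for x w
  proof
    assume "nb G x \<subseteq> insert w P4"
    then have "nb G x \<subseteq> {u}" using ind[OF that(1)] e4 nb_sym[of w G x] that(2) by auto
    then have "card (nb G x) \<le> card {u}" by (intro card_mono) auto
    moreover have "x \<in> verts G" using that(1) cubicD(5)[OF G(1)] by blast
    ultimately show False using cubicD(3)[OF G(1), of x] by simp
  qed
  obtain x0 where x0: "x0 \<in> nb G u" using cubicD(3)[OF G(1) uV] by fastforce
  have "P4 \<noteq> verts G"
    using leaf[OF x0] cubicD(5)[OF G(1), of x0] cubicD(6)[OF G(1), of x0] by blast
  then obtain v where v: "v \<in> verts G" "v \<notin> P4" "card (bd G (insert v P4)) \<le> 3"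
    "completable G (insert v P4)" using completable_next[OF P4(1)] by metis
  have leaf': "\<not> nb G x \<subseteq> insert v P4" if "x \<in> nb G u" for x
  proof
    assume "nb G x \<subseteq> insert v P4"
    then have "nb G x \<subseteq> {u, v}" using ind[OF that] e4 by auto
    then have "card (nb G x) \<le> card {u, v}" by (intro card_mono) auto
    also have "\<dots> \<le> 2" by (simp add: card_insert_if)
    finally show False using cubicD(3)[OF G(1), of x] cubicD(5)[OF G(1), of u] that by auto
  qed
  then have "nb G u \<subseteq> bd G (insert v P4)" using u by (auto simp: bd_def)
  moreover have "finite (bd G (insert v P4))" using f4 by (simp add: bd_def)
  ultimately have b: "bd G (insert v P4) = nb G u"
    using v(3) cubicD(3)[OF G(1) uV] card_seteq by metis
  then have "v \<notin> bd G (insert v P4)" using v(2) u by auto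
  then have "nb G v \<subseteq> insert v P4" by (simp add: bd_def)
  moreover have "v \<notin> nb G v" using cubicD(6)[OF G(1)] .
  moreover have "u \<notin> nb G v" using nb_symD[of u G v] u v(2) by blast
  ultimately have "nb G v \<subseteq> nb G u" using e4 by blast
  then have "nb G v = nb G u"
    using cubicD(3)[OF G(1) uV] cubicD(3)[OF G(1) v(1)] cubicD(4)[OF G(1)] by (intro card_subset_eq)
        auto
  moreover have "insert v P4 = {u, v} \<union> nb G u" using e4 by auto
  ultimately show thesis using that[of u v] uV v u by auto
qed

text \<open>Vertices enter in the order of their first bags \<open>b\<close>. Let \<open>w\<close>
  come next. A \<open>p\<close> in \<open>P\<close> with an outside neighbour \<open>q\<close> has
  its first bag no later than that of \<open>w\<close>, and shares with \<open>q\<close> a bag no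
  earlier than that; so \<open>p\<close> lies in the first bag of \<open>w\<close>, which has room
  for three vertices besides \<open>w\<close>.\<close>

lemma completable_if_path_decomposition:
  assumes simple: "simple_graph G"
    and pd: "path_decomposition G bags" and width: "\<And>B. B \<in> set bags \<Longrightarrow> card B \<le> 4"
  shows "completable G {}"
proof -
  have fin: "finite (verts G)" using simple by (simp add: simple_graph_def)
  define b where "b v = (LEAST i. i < length bags \<and> v \<in> bags ! i)" for v
  have b: "b v < length bags" "v \<in> bags ! b v" if "v \<in> verts G" for v
  proof -
    have "\<exists>B\<in>set bags. v \<in> B" using pd that by (auto simp: path_decomposition_def)
    then have "\<exists>i. i < length bags \<and> v \<in> bags ! i" by (metis in_set_conv_nth)
    from LeastI_ex[OF this] show "b v < length bags" "v \<in> bags ! b v" by (simp_all add: b_def)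
  qed
  have b_le: "b v \<le> i" if "i < length bags" "v \<in> bags ! i" for v i
    unfolding b_def using that by (intro Least_le) simp
  have interval: "v \<in> bags ! j" if "v \<in> verts G" "i \<le> j" "j \<le> k" "k < length bags" "v \<in> bags ! i" "v
      \<in> bags ! k"
    for v i j k using pd that unfolding path_decomposition_def by blast
  have small: "card (bd G P) \<le> 3" if P: "P \<subseteq> verts G"
    and closed: "\<forall>p\<in>P. \<forall>q\<in>verts G - P. b p \<le> b q" for P
  proof (cases "P = verts G")
    case True
    then have "bd G P = {}" using nb_verts(2)[OF simple] by (fastforce simp: bd_def)
    then show ?thesis by simp
  next
    case False
    then have "verts G - P \<noteq> {}" using P by blast
    then obtain w where w: "w \<in> verts G - P" "\<And>q. q \<in> verts G - P \<Longrightarrow> b w \<le> b q"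
      using fin ex_is_arg_min_if_finite[of "verts G - P" b] by (auto simp: is_arg_min_linorder)
    let ?B = "bags ! b w"
    have "?B \<in> set bags" using b(1)[of w] w by simp
    then have B: "card ?B \<le> 4" "?B \<subseteq> verts G"
      using width pd by (auto simp: path_decomposition_def)
    then have fB: "finite ?B" using fin finite_subset by blast
    have "bd G P \<subseteq> ?B - {w}"
    proof
      fix p assume "p \<in> bd G P"
      then obtain q where q: "p \<in> P" "q \<in> nb G p" "q \<notin> P" by (auto simp: bd_def)
      then have qV: "q \<in> verts G - P" using nb_verts(2)[OF simple] by blast
      have "{p, q} \<in> edges G" using q(2) by (simp add: nb_def)
      then have "\<exists>B\<in>set bags. {p, q} \<subseteq> B" using pd unfolding path_decomposition_def by blast
      then obtain i where i: "i < length bags" "p \<in> bags ! i" "q \<in> bags ! i"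
        by (metis in_set_conv_nth insert_subset)
      have "b w \<le> i" using w(2)[OF qV] b_le[OF i(1,3)] by linarith
      moreover have "b p \<le> b w" using closed q(1) w(1) by blast
      ultimately have "p \<in> ?B" using interval[of p "b p" "b w" i] P q(1) b(2)[of p] i by blast
      then show "p \<in> ?B - {w}" using q(1) w(1) by auto
    qed
    then have "card (bd G P) \<le> card (?B - {w})" using fB by (intro card_mono) auto
    also have "\<dots> \<le> 3" using b(2)[of w] w(1) B(1) fB by simp
    finally show ?thesis .
  qed
  have "completable G P" if "P \<subseteq> verts G" "\<forall>p\<in>P. \<forall>q\<in>verts G - P. b p \<le> b q" for P
    using that
  proof (induction "card (verts G - P)" arbitrary: P rule: less_induct)
    case less
    show ?case
    proof (cases "P = verts G")
      case True
      then show ?thesis using completable.full by simp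
    next
      case False
      then have "verts G - P \<noteq> {}" using less.prems by blast
      then obtain w where w: "w \<in> verts G - P" "\<And>q. q \<in> verts G - P \<Longrightarrow> b w \<le> b q"
        using fin ex_is_arg_min_if_finite[of "verts G - P" b] by (auto simp: is_arg_min_linorder)
      have P': "insert w P \<subseteq> verts G" "\<forall>p\<in>insert w P. \<forall>q\<in>verts G - insert w P. b p \<le> b q"
        using less.prems w by auto
      have "card (verts G - insert w P) < card (verts G - P)"
        using fin w(1) by (intro psubset_card_mono) auto
      then have "completable G (insert w P)" using less.hyps P' by blast
      then show ?thesis using completable.step[OF w(1) small[OF P']] by blast
    qed
  qed
  from this[of "{}"] show ?thesis by simp
qed

lemma path_width_bags:
  assumes "path_width G = k" and fin: "finite (verts G)" "\<forall>e\<in>edges G. e \<subseteq> verts G"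
  obtains bags where "path_decomposition G bags" "\<And>B. B \<in> set bags \<Longrightarrow> card B \<le> Suc k"
proof -
  \<comment> \<open>The single bag \<open>verts G\<close> ensures that the \<open>LEAST\<close> in
    \<open>path_width\<close> is attained.\<close>
  have "path_decomposition G [verts G]"
    using fin by (auto simp: path_decomposition_def)
  then have "\<exists>k bags. path_decomposition G bags \<and> decomposition_width bags = k" by blast
  from LeastI_ex[OF this] obtain bags
    where bags: "path_decomposition G bags" "decomposition_width bags = k"
    using assms(1) unfolding path_width_def by blast
  have "card B \<le> Suc k" if "B \<in> set bags" for B
  proof -
    have "card B \<le> Max (card ` set bags)" using that by (intro Max_ge) auto
    then show ?thesis using bags(2) unfolding decomposition_width_def by linarith
  qed
  with bags that show thesis by blast
qed

text \<open>The bound on \<open>k\<close> reflects that the initial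
  \<open>K\<^sub>2\<^sub>,\<^sub>3\<close> has five vertices, as
  \<open>attached_if_cut_connected\<close> asks for more than \<open>k\<close>.\<close>

lemma K23_start_if_path_width_3:
  assumes G: "cubic_graph G" and pw: "path_width G = 3" and g: "girth G = 4" and k: "k \<le> 4"
    and conn: "\<And>S. S \<subseteq> verts G \<Longrightarrow> card S < k \<Longrightarrow> connected_graph (delete_verts G S)"
  shows "K23_start k G"
proof -
  have tf: "triangle_free G" by (rule triangle_free_if_girth[OF cubicD(1)[OF G] g])
  have "\<forall>e\<in>edges G. e \<subseteq> verts G" using cubicD(1)[OF G] by (auto simp: simple_graph_def)
  then obtain bags where "path_decomposition G bags" "\<And>B. B \<in> set bags \<Longrightarrow> card B \<le> Suc 3"
    using path_width_bags[OF pw cubicD(2)[OF G]] by blast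
  then have "completable G {}"
    using completable_if_path_decomposition[OF cubicD(1)[OF G], of bags] by simp
  then obtain u v where uv: "u \<in> verts G" "u \<noteq> v" "nb G u = nb G v"
      "completable G ({u, v} \<union> nb G u)"
    using completable_empty_K23[OF G tf] by blast
  have "u \<notin> nb G u" "v \<notin> nb G u" using cubicD(6)[OF G, of u] cubicD(6)[OF G, of v] uv(3) by auto
  then have "card ({u, v} \<union> nb G u) = 5"
    using uv(2) cubicD(3)[OF G uv(1)] cubicD(4)[OF G, of u] by simp
  then have "attached k G ({u, v} \<union> nb G u)"
    using k completable_subset[OF uv(4)] by (intro attached_if_cut_connected[OF G _ _ conn]) auto
  then show ?thesis unfolding K23_start_def using G tf uv by blast
qed

text \<open>Connectedness in the second part excludes graphs such as two disjoint copies of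
  \<open>K\<^sub>3\<^sub>,\<^sub>3\<close>, which no sequence of steps can produce, because every
  step keeps a connected graph connected.\<close>

theorem theorem4:
  fixes G :: "'a ugraph"
  shows "(k_connected 3 G \<and> cubic_graph G \<and> path_width G = 3 \<and> girth G = 4 \<longrightarrow>
            obtainable_from_K33 {C1, C2} G) \<and>
         (connected_graph G \<and> cubic_graph G \<and> path_width G = 3 \<and> girth G = 4 \<longrightarrow>
            obtainable_from_K33 {C1, C2, C3, C4, C5, C6} G)"
proof (intro conjI impI)
  assume A: "k_connected 3 G \<and> cubic_graph G \<and> path_width G = 3 \<and> girth G = 4"
  then have "K23_start 3 G" by (intro K23_start_if_path_width_3) (auto simp: k_connected_def)
  then show "obtainable_from_K33 {C1, C2} G" by (rule K23_start_obtainable) simp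
next
  assume A: "connected_graph G \<and> cubic_graph G \<and> path_width G = 3 \<and> girth G = 4"
  \<comment> \<open>For \<open>k = 1\<close> only the empty set has to be deleted, so connectedness
    of \<open>G\<close> itself is enough.\<close>
  have "connected_graph (delete_verts G S)" if "S \<subseteq> verts G" "card S < 1" for S
  proof -
    have "S = {}" using that A cubicD(2)[of G] finite_subset by fastforce
    then show ?thesis using A by (simp add: delete_verts_def connected_graph_def)
  qed
  then have "K23_start 1 G" using A by (intro K23_start_if_path_width_3) auto
  then show "obtainable_from_K33 {C1, C2, C3, C4, C5, C6} G" by (rule K23_start_obtainable) simp
qed

end
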